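(* Let $G$ be a group. The following are equivalent. (a) There exists a subgroup $K < G$ with $e(G,K)>1$. (b) $G$ admits a non elliptic action on a simple discrete median algebra. (c) $G$ admits an essential action on a discrete median algebra. Moreover, in case (b) let $H$ be any proper half space of the median algebra, and in case (c) let $H$ be an essential half space; then $e(G,G_H)>1$, where $G_H=\{g\in G: gH=H\}$. Conversely, if $K<G$ and $e(G,K)>1$, then actions as in (b) and (c) exist together with a half space $H$ (proper in case (b), essential in case (c)) whose stabilizer $G_H$ contains $K$ as a subgroup of finite index.
   Context: Ends: for a subgroup $K\le G$, let $\mathscr{P}K\backslash G$ be the set of subsets $A\subseteq G$ with $KA=A$, a right $\mathbb{F}_2G$-module under symmetric difference and right multiplication; let $\mathscr{F}K\backslash G$ be the submodule of $K$-finite sets, i.e. sets of the form $KF$ with $F\subseteq G$ finite. Then $e(G,K):=\dim_{\mathbb{F}_2}\big((\mathscr{P}K\backslash G)/(\mathscr{F}K\backslash G)\big)^G$, the dimension of the $G$-fixed submodule. A median algebra is a nonempty set $M$ with a map $m: M^3\to M$ such that: $m(x,y,z)=m(x,z,y)=m(y,z,x)$; $m(x,x,y)=x$; $m(m(x,y,z),u,v)=m(x,m(y,u,v),m(z,u,v))$. Interval: $[x,y]=\{z: z=m(x,y,z)\}$. $C\subseteq M$ is convex if $[x,y]\subseteq C$ for all $x,y\in C$. A half space is a subset $H\subseteq M$ such that $H$ and $H^*:=M\setminus H$ are both convex; it is proper if $H\ne\varnothing,M$. $\Delta(x,y)$ is the set of half spaces containing $x$ but not $y$; $M$ is discrete if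 all $\Delta(x,y)$ are finite, and then $d(x,y)=|\Delta(x,y)|$ is a metric on $M$. Groups act on median algebras by median automorphisms. For an action of $G$ on a discrete median algebra $M$: a subset of $M$ is bounded if it has finite diameter for $d$. The action is elliptic if for some (equivalently every) $x\in M$ the orbit $Gx$ is bounded. A half space $H$ cuts $M$ properly if for some (equivalently every) $x\in M$ both $H\cap Gx$ and $H^*\cap Gx$ are unbounded. $H$ is essential if $H$ cuts $M$ properly and the orbit $GH=\{gH:g\in G\}$ is infinite. The action is essential if there exists an essential half space. $M$ is simple (as a $G$-median algebra) if for any two proper half spaces $H,J$ there is $g\in G$ with $J=gH$ or $J^*=gH$.
   Formalization: "H cuts M properly" is taken to mean that H∩Gx and H*∩Gx are unbounded for every x in M; "for some x" is not equivalent, and with it e(G,G_H)>1 can fail (Z×Z² acting on Z×star, H = Z×{leaf}). *)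

theory Defs
  imports
    "HOL-Library.Extended_Nat"
    "HOL-Algebra.Group_Action"
    "HOL-Number_Theory.Residues"
    "Jordan_Normal_Form.Missing_VectorSpace"
begin

section \<open>Ends of a pair of groups\<close>

text \<open>The field with two elements is \<^term>\<open>residue_ring 2\<close>.\<close>

text \<open>Only the additive and scalar structure of a \<^typ>\<open>('a, 'b) module\<close> record is relevant;
  its \<open>mult\<close> and \<open>one\<close> fields are never used.\<close>

definition power_module :: "('g, 'x) monoid_scheme \<Rightarrow> 'g set \<Rightarrow> (int, 'g set) module" where
  "power_module G K =
     \<lparr>carrier = {A. A \<subseteq> carrier G \<and> K <#>\<^bsub>G\<^esub> A = A}, monoid.mult = undefined, one = undefined,
      zero = {}, add = sym_diff, smult = (\<lambda>a A. if a = 0 then {} else A)\<rparr>"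

definition K_finite_sets :: "('g, 'x) monoid_scheme \<Rightarrow> 'g set \<Rightarrow> 'g set set" where
  "K_finite_sets G K = {K <#>\<^bsub>G\<^esub> F | F. F \<subseteq> carrier G \<and> finite F}"

definition quot_module :: "('a, 'b, 'c) module_scheme \<Rightarrow> 'b set \<Rightarrow> ('a, 'b set) module" where
  "quot_module V N =
     \<lparr>carrier = a_rcosets\<^bsub>V\<^esub> N, monoid.mult = undefined, one = undefined,
      zero = N, add = (<+>\<^bsub>V\<^esub>),
      smult = (\<lambda>a X. \<Union>x\<in>X. N +>\<^bsub>V\<^esub> (a \<odot>\<^bsub>V\<^esub> x))\<rparr>"

definition end_module :: "('g, 'x) monoid_scheme \<Rightarrow> 'g set \<Rightarrow> (int, 'g set set) module" where
  "end_module G K = quot_module (power_module G K) (K_finite_sets G K)"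

text \<open>An element \<open>g\<close> acts on a coset \<open>X\<close> of the \<open>K\<close>-finite sets by right translation of all
  members of \<open>X\<close>.\<close>

definition end_module_fixed :: "('g, 'x) monoid_scheme \<Rightarrow> 'g set \<Rightarrow> 'g set set set" where
  "end_module_fixed G K =
     {X \<in> carrier (end_module G K). \<forall>g \<in> carrier G. (\<lambda>A. A #>\<^bsub>G\<^esub> g) ` X = X}"

text \<open>The library's \<open>vectorspace.dim\<close> is a natural number and only meaningful in the
  finite-dimensional case.\<close>

definition edim :: "('a, 'e) ring_scheme \<Rightarrow> ('a, 'b, 'c) module_scheme \<Rightarrow> enat" where
  "edim F V = (if vectorspace.fin_dim F V then enat (vectorspace.dim F V) else \<infinity>)"

definition ends :: "('g, 'x) monoid_scheme \<Rightarrow> 'g set \<Rightarrow> enat" where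
  "ends G K = edim (residue_ring 2) ((end_module G K)\<lparr>carrier := end_module_fixed G K\<rparr>)"


section \<open>Median algebras\<close>

locale median_algebra =
  fixes M :: "'m set" and m :: "'m \<Rightarrow> 'm \<Rightarrow> 'm \<Rightarrow> 'm"
  assumes nonempty: "M \<noteq> {}"
    and closed: "\<lbrakk>x \<in> M; y \<in> M; z \<in> M\<rbrakk> \<Longrightarrow> m x y z \<in> M"
    and swap: "\<lbrakk>x \<in> M; y \<in> M; z \<in> M\<rbrakk> \<Longrightarrow> m x y z = m x z y"
    and rotate: "\<lbrakk>x \<in> M; y \<in> M; z \<in> M\<rbrakk> \<Longrightarrow> m x y z = m y z x"
    and majority: "\<lbrakk>x \<in> M; y \<in> M\<rbrakk> \<Longrightarrow> m x x y = x"
    and distrib: "\<lbrakk>x \<in> M; y \<in> M; z \<in> M; u \<in> M; v \<in> M\<rbrakk>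
                  \<Longrightarrow> m (m x y z) u v = m x (m y u v) (m z u v)"

definition med_interval :: "'m set \<Rightarrow> ('m \<Rightarrow> 'm \<Rightarrow> 'm \<Rightarrow> 'm) \<Rightarrow> 'm \<Rightarrow> 'm \<Rightarrow> 'm set" where
  "med_interval M m x y = {z \<in> M. z = m x y z}"

definition med_convex :: "'m set \<Rightarrow> ('m \<Rightarrow> 'm \<Rightarrow> 'm \<Rightarrow> 'm) \<Rightarrow> 'm set \<Rightarrow> bool" where
  "med_convex M m C \<longleftrightarrow> C \<subseteq> M \<and> (\<forall>x\<in>C. \<forall>y\<in>C. med_interval M m x y \<subseteq> C)"

definition half_space :: "'m set \<Rightarrow> ('m \<Rightarrow> 'm \<Rightarrow> 'm \<Rightarrow> 'm) \<Rightarrow> 'm set \<Rightarrow> bool" where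
  "half_space M m H \<longleftrightarrow> H \<subseteq> M \<and> med_convex M m H \<and> med_convex M m (M - H)"

definition proper_half_space :: "'m set \<Rightarrow> ('m \<Rightarrow> 'm \<Rightarrow> 'm \<Rightarrow> 'm) \<Rightarrow> 'm set \<Rightarrow> bool" where
  "proper_half_space M m H \<longleftrightarrow> half_space M m H \<and> H \<noteq> {} \<and> H \<noteq> M"

definition separating :: "'m set \<Rightarrow> ('m \<Rightarrow> 'm \<Rightarrow> 'm \<Rightarrow> 'm) \<Rightarrow> 'm \<Rightarrow> 'm \<Rightarrow> 'm set set" where
  "separating M m x y = {H. half_space M m H \<and> x \<in> H \<and> y \<notin> H}"

definition med_discrete :: "'m set \<Rightarrow> ('m \<Rightarrow> 'm \<Rightarrow> 'm \<Rightarrow> 'm) \<Rightarrow> bool" where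
  "med_discrete M m \<longleftrightarrow> (\<forall>x\<in>M. \<forall>y\<in>M. finite (separating M m x y))"

definition med_dist :: "'m set \<Rightarrow> ('m \<Rightarrow> 'm \<Rightarrow> 'm \<Rightarrow> 'm) \<Rightarrow> 'm \<Rightarrow> 'm \<Rightarrow> nat" where
  "med_dist M m x y = card (separating M m x y)"

definition med_bounded :: "'m set \<Rightarrow> ('m \<Rightarrow> 'm \<Rightarrow> 'm \<Rightarrow> 'm) \<Rightarrow> 'm set \<Rightarrow> bool" where
  "med_bounded M m S \<longleftrightarrow> S \<subseteq> M \<and> (\<exists>n. \<forall>x\<in>S. \<forall>y\<in>S. med_dist M m x y \<le> n)"


section \<open>Actions on median algebras\<close>

locale median_action = median_algebra M m + group_action G M \<phi>
  for G :: "('g, 'x) monoid_scheme" and M :: "'m set" and m \<phi> +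
  assumes equivariant: "\<lbrakk>g \<in> carrier G; x \<in> M; y \<in> M; z \<in> M\<rbrakk>
                        \<Longrightarrow> \<phi> g (m x y z) = m (\<phi> g x) (\<phi> g y) (\<phi> g z)"

text \<open>The induced operation on subsets, suited for the library's \<^const>\<open>orbit\<close> and
  \<^const>\<open>stabilizer\<close>.\<close>

abbreviation set_act :: "('g \<Rightarrow> 'm \<Rightarrow> 'm) \<Rightarrow> 'g \<Rightarrow> 'm set \<Rightarrow> 'm set" where
  "set_act \<phi> g H \<equiv> \<phi> g ` H"

definition elliptic :: "('g, 'x) monoid_scheme \<Rightarrow> 'm set \<Rightarrow> ('m \<Rightarrow> 'm \<Rightarrow> 'm \<Rightarrow> 'm) \<Rightarrow>
    ('g \<Rightarrow> 'm \<Rightarrow> 'm) \<Rightarrow> bool" where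
  "elliptic G M m \<phi> \<longleftrightarrow> (\<exists>x\<in>M. med_bounded M m (orbit G \<phi> x))"

text \<open>The base point \<open>x\<close> is quantified universally. The version with ``some \<open>x\<close>'' is strictly
  weaker: let \<open>star\<close> be the tree with a centre and one leaf for each element of \<open>Z^2\<close>, and let
  \<open>G = Z \<times> Z^2\<close> act on \<open>Z \<times> star\<close>. For the half space \<open>H = Z \<times> {leaf}\<close>, both \<open>H\<close> and its
  complement meet the orbit of \<open>(0, leaf)\<close> in unbounded sets, but \<open>H\<close> misses the orbit of
  \<open>(0, centre)\<close>. Moreover \<open>H\<close> has infinitely many translates, whereas the stabilizer \<open>Z\<close> of \<open>H\<close>
  satisfies \<open>e(G, Z) = e(Z^2) = 1\<close>.\<close>

definition cuts_properly :: "('g, 'x) monoid_scheme \<Rightarrow> 'm set \<Rightarrow> ('m \<Rightarrow> 'm \<Rightarrow> 'm \<Rightarrow> 'm) \<Rightarrow>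
    ('g \<Rightarrow> 'm \<Rightarrow> 'm) \<Rightarrow> 'm set \<Rightarrow> bool" where
  "cuts_properly G M m \<phi> H \<longleftrightarrow>
     (\<forall>x\<in>M. \<not> med_bounded M m (H \<inter> orbit G \<phi> x) \<and> \<not> med_bounded M m ((M - H) \<inter> orbit G \<phi> x))"

definition essential_half_space :: "('g, 'x) monoid_scheme \<Rightarrow> 'm set \<Rightarrow>
    ('m \<Rightarrow> 'm \<Rightarrow> 'm \<Rightarrow> 'm) \<Rightarrow> ('g \<Rightarrow> 'm \<Rightarrow> 'm) \<Rightarrow> 'm set \<Rightarrow> bool" where
  "essential_half_space G M m \<phi> H \<longleftrightarrow>
     half_space M m H \<and> cuts_properly G M m \<phi> H \<and> infinite (orbit G (set_act \<phi>) H)"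

definition med_simple :: "('g, 'x) monoid_scheme \<Rightarrow> 'm set \<Rightarrow> ('m \<Rightarrow> 'm \<Rightarrow> 'm \<Rightarrow> 'm) \<Rightarrow>
    ('g \<Rightarrow> 'm \<Rightarrow> 'm) \<Rightarrow> bool" where
  "med_simple G M m \<phi> \<longleftrightarrow>
     (\<forall>H J. proper_half_space M m H \<and> proper_half_space M m J \<longrightarrow>
        (\<exists>g\<in>carrier G. J = set_act \<phi> g H \<or> M - J = set_act \<phi> g H))"

definition nonelliptic_simple_action :: "('g, 'x) monoid_scheme \<Rightarrow> 'm set \<Rightarrow>
    ('m \<Rightarrow> 'm \<Rightarrow> 'm \<Rightarrow> 'm) \<Rightarrow> ('g \<Rightarrow> 'm \<Rightarrow> 'm) \<Rightarrow> bool" where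
  "nonelliptic_simple_action G M m \<phi> \<longleftrightarrow>
     median_action G M m \<phi> \<and> med_discrete M m \<and> med_simple G M m \<phi> \<and> \<not> elliptic G M m \<phi>"

definition essential_action :: "('g, 'x) monoid_scheme \<Rightarrow> 'm set \<Rightarrow>
    ('m \<Rightarrow> 'm \<Rightarrow> 'm \<Rightarrow> 'm) \<Rightarrow> ('g \<Rightarrow> 'm \<Rightarrow> 'm) \<Rightarrow> bool" where
  "essential_action G M m \<phi> \<longleftrightarrow>
     median_action G M m \<phi> \<and> med_discrete M m \<and> (\<exists>H. essential_half_space G M m \<phi> H)"

definition finite_index_in :: "('g, 'x) monoid_scheme \<Rightarrow> 'g set \<Rightarrow> 'g set \<Rightarrow> bool" where
  "finite_index_in G K L \<longleftrightarrow>
     subgroup K (G\<lparr>carrier := L\<rparr>) \<and> finite (rcosets\<^bsub>G\<lparr>carrier := L\<rparr>\<^esub> K)"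

end

theory Submission
  imports Defs
begin

text \<open>
  A class in the quotient of the \<open>K\<close>-invariant sets by the \<open>K\<close>-finite sets is fixed by \<open>G\<close> exactly
  when its representatives \<open>A\<close> are \<^emph>\<open>almost invariant\<close>: \<open>K A = A\<close>, and \<open>A\<close> differs from every
  translate \<open>A g\<close> by a \<open>K\<close>-finite set. The whole group is almost invariant, so the dimension
  exceeds one iff some almost invariant \<open>A\<close> is neither \<open>K\<close>-finite nor the complement of a
  \<open>K\<close>-finite set (lemma \<open>ends_gt_one_iff\<close>).

  \<^bold>\<open>From actions to ends.\<close> For a half space \<open>H\<close> and a point \<open>x\<close>, the set of all \<open>g\<close> with
  \<open>g x\<close> in \<open>H\<close> is almost invariant for the stabilizer of \<open>H\<close>: right translation by \<open>g\<close> changes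
  the base point, which matters only for the finitely many translates of \<open>H\<close> that separate \<open>x\<close>
  from its image. It is finite modulo the stabilizer iff only finitely many translates of \<open>H\<close>
  contain \<open>x\<close>. Hence it suffices that infinitely many translates of \<open>H\<close>, and of its complement,
  contain \<open>x\<close>. In a simple action every proper half space is a translate of \<open>H\<close> or of the
  complement; if only \<open>n\<close> translates of \<open>H\<close> contained \<open>x\<close>, this would also hold for all points of
  its orbit, and the orbit would have diameter at most \<open>2 n\<close>. For an essential half space with only
  finitely many translates around each point, a point in the least number of them can be pushed
  out of one by moving to the nearest point of the complement. This enters no other translate,
  so the least number is zero, although \<open>H\<close> meets every orbit.

  \<^bold>\<open>From ends to actions.\<close> Given a nontrivial almost invariant set \<open>A\<close>, its left translates and
  their complements form a set of walls on \<open>G\<close>. Almost invariance says that two elements are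
  separated by finitely many walls. The ultrafilters of sides at finite distance from a
  point of \<open>G\<close> form a discrete median algebra, whose proper half spaces correspond
  bijectively to the sides of walls; so the action is simple, and the stabilizer of
  the half space of \<open>A\<close> is \<open>{g. g A = A}\<close>, a finite extension of \<open>K\<close>. That no orbit is bounded
  is the analytic core (lemma \<open>displacement_unbounded\<close>): if a subset of a transitive
  \<open>G\<close>-set were moved by a bounded amount, a circumcentre argument in \<open>\<ell>\<^sup>2\<close> would give nearly
  invariant functions close to its indicator, which transitivity allows only if the subset is
  finite or cofinite. In an action with unbounded orbits, infinitely many translates of \<open>H\<close>
  around \<open>x\<close> force \<open>H\<close> to meet the orbit of \<open>x\<close> in an unbounded set, since a far point of the
  orbit would otherwise be separated from \<open>x\<close> by all of them. Therefore the half space of \<open>A\<close> is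
  also essential.
\<close>

section \<open>Almost invariant sets and the number of ends\<close>

locale subgroup_pair = group G + K: subgroup K G
  for G :: "('g, 'x) monoid_scheme" (structure) and K
begin

definition left_invariant :: "'g set \<Rightarrow> bool" where
  "left_invariant A \<longleftrightarrow> A \<subseteq> carrier G \<and> (\<forall>k\<in>K. \<forall>a\<in>A. k \<otimes> a \<in> A)"

lemma left_invariant_iff: "left_invariant A \<longleftrightarrow> A \<subseteq> carrier G \<and> K <#> A = A"
proof -
  have "A \<subseteq> K <#> A" if "A \<subseteq> carrier G"
    using that by (force simp: set_mult_def intro: K.one_closed)
  then show ?thesis
    unfolding left_invariant_def set_mult_def by blast
qed

lemma left_invariant_carrier: "left_invariant (carrier G)"
  by (auto simp: left_invariant_def)

lemma left_invariant_mult_iff: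
  assumes "left_invariant A" "k \<in> K" "a \<in> carrier G"
  shows "k \<otimes> a \<in> A \<longleftrightarrow> a \<in> A"
proof -
  have "inv k \<otimes> (k \<otimes> a) = a"
    using assms by (simp flip: m_assoc)
  then show ?thesis
    using assms unfolding left_invariant_def by (metis K.m_inv_closed)
qed

lemma left_invariant_sym_diff:
  assumes "left_invariant A" "left_invariant B"
  shows "left_invariant (sym_diff A B)"
proof -
  have sub: "sym_diff A B \<subseteq> carrier G"
    using assms by (auto simp: left_invariant_def)
  moreover have "k \<otimes> a \<in> sym_diff A B" if "k \<in> K" "a \<in> sym_diff A B" for k a
    using that subsetD[OF sub that(2)] assms by (simp add: left_invariant_mult_iff)
  ultimately show ?thesis
    by (simp only: left_invariant_def) simp
qed

lemma left_invariant_complement: "left_invariant A \<Longrightarrow> left_invariant (carrier G - A)"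
  using left_invariant_sym_diff[OF left_invariant_carrier, of A]
  by (simp add: left_invariant_def Un_absorb2 Diff_eq_empty_iff[THEN iffD2])

lemma left_invariant_r_coset:
  assumes "left_invariant A" "g \<in> carrier G"
  shows "left_invariant (A #> g)"
  using assms by (fastforce simp: left_invariant_def r_coset_def m_assoc[symmetric])

text \<open>Counting cosets instead of representatives makes the \<open>K\<close>-finite sets visibly closed under
  unions and under passing to invariant subsets.\<close>

lemma K_finite_iff:
  "A \<in> K_finite_sets G K \<longleftrightarrow> left_invariant A \<and> finite ((#>) K ` A)"
proof
  assume "A \<in> K_finite_sets G K"
  then obtain F where F: "F \<subseteq> carrier G" "finite F" "A = K <#> F"
    by (auto simp: K_finite_sets_def)
  have "K #> (k \<otimes> f) = K #> f" if "k \<in> K" "f \<in> F" for k f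
    using that F(1) K.subgroup_axioms
    by (metis (no_types, lifting) K.mem_carrier coset_join2 coset_mult_assoc K.subset subsetD)
  then have "(#>) K ` A \<subseteq> (#>) K ` F"
    by (auto simp: F set_mult_def)
  moreover have "left_invariant A"
    using F(1) by (force simp: F left_invariant_def set_mult_def m_assoc[symmetric] subset_iff)
  ultimately show "left_invariant A \<and> finite ((#>) K ` A)"
    using F(2) finite_subset by blast
next
  assume A: "left_invariant A \<and> finite ((#>) K ` A)"
  then obtain F where F: "F \<subseteq> A" "finite F" "(#>) K ` A = (#>) K ` F"
    by (meson finite_subset_image subset_refl)
  have "A = K <#> F"
  proof
    show "K <#> F \<subseteq> A"
      using A F(1) by (auto simp: left_invariant_def set_mult_def)
    show "A \<subseteq> K <#> F"
    proof
      fix a assume a: "a \<in> A"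
      then obtain f where f: "f \<in> F" "K #> a = K #> f"
        using F(3) by (metis imageE imageI)
      have "a \<in> K #> a"
        using a A by (auto simp: left_invariant_def intro!: rcos_self K.subgroup_axioms)
      then show "a \<in> K <#> F"
        using f by (simp add: r_coset_def set_mult_def) blast
    qed
  qed
  then show "A \<in> K_finite_sets G K"
    using A F unfolding K_finite_sets_def left_invariant_def by blast
qed

lemma K_finite_empty: "{} \<in> K_finite_sets G K"
  by (auto simp: K_finite_iff left_invariant_def)

lemma K_finite_subset:
  "\<lbrakk>B \<in> K_finite_sets G K; A \<subseteq> B; left_invariant A\<rbrakk> \<Longrightarrow> A \<in> K_finite_sets G K"
  by (meson K_finite_iff finite_subset image_mono)

lemma K_finite_Un:
  "\<lbrakk>A \<in> K_finite_sets G K; B \<in> K_finite_sets G K\<rbrakk> \<Longrightarrow> A \<union> B \<in> K_finite_sets G K"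
  by (auto simp: K_finite_iff left_invariant_def image_Un)

lemma K_finite_sym_diff:
  assumes "A \<in> K_finite_sets G K" "B \<in> K_finite_sets G K"
  shows "sym_diff A B \<in> K_finite_sets G K"
proof (rule K_finite_subset[OF K_finite_Un[OF assms]])
  show "left_invariant (sym_diff A B)"
    using assms K_finite_iff left_invariant_sym_diff by blast
qed auto

lemma K_finite_r_coset:
  assumes "A \<in> K_finite_sets G K" "g \<in> carrier G"
  shows "A #> g \<in> K_finite_sets G K"
proof -
  obtain F where F: "F \<subseteq> carrier G" "finite F" "A = K <#> F"
    using assms(1) by (auto simp: K_finite_sets_def)
  have "A #> g = K <#> (F #> g)"
    using F(1) assms(2) K.subset by (simp add: F setmult_rcos_assoc)
  moreover have "F #> g \<subseteq> carrier G" "finite (F #> g)"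
    using F assms(2) by (auto simp: r_coset_def)
  ultimately show ?thesis
    unfolding K_finite_sets_def by blast
qed

definition almost_invariant :: "'g set \<Rightarrow> bool" where
  "almost_invariant A \<longleftrightarrow>
     left_invariant A \<and> (\<forall>g\<in>carrier G. sym_diff A (A #> g) \<in> K_finite_sets G K)"

lemma r_coset_sym_diff:
  assumes "A \<subseteq> carrier G" "B \<subseteq> carrier G" "g \<in> carrier G"
  shows "sym_diff A B #> g = sym_diff (A #> g) (B #> g)"
proof -
  have "x = y" if "x \<in> carrier G" "y \<in> carrier G" "x \<otimes> g = y \<otimes> g" for x y
    using that assms(3) by simp
  then show ?thesis
    using assms by (auto simp: r_coset_def subset_iff; metis)
qed

lemma almost_invariant_carrier: "almost_invariant (carrier G)"
proof -
  have "carrier G #> g = carrier G" if "g \<in> carrier G" for g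
    using that by (simp add: coset_join2 subgroup_self)
  then show ?thesis
    using left_invariant_carrier K_finite_empty by (simp add: almost_invariant_def)
qed

lemma K_finite_almost_invariant: "A \<in> K_finite_sets G K \<Longrightarrow> almost_invariant A"
  unfolding almost_invariant_def
  using K_finite_iff K_finite_sym_diff K_finite_r_coset by blast

lemma almost_invariant_sym_diff:
  assumes "almost_invariant A" "almost_invariant B"
  shows "almost_invariant (sym_diff A B)"
  unfolding almost_invariant_def
proof (intro conjI ballI)
  show "left_invariant (sym_diff A B)"
    using assms left_invariant_sym_diff unfolding almost_invariant_def by blast
  fix g assume g: "g \<in> carrier G"
  have "sym_diff A B #> g = sym_diff (A #> g) (B #> g)"
    using assms g by (simp add: r_coset_sym_diff almost_invariant_def left_invariant_def)
  moreover have "sym_diff (sym_diff A B) (sym_diff A' B') =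
      sym_diff (sym_diff A A') (sym_diff B B')" for A' B'
    by blast
  ultimately have "sym_diff (sym_diff A B) (sym_diff A B #> g) =
      sym_diff (sym_diff A (A #> g)) (sym_diff B (B #> g))"
    by simp
  then show "sym_diff (sym_diff A B) (sym_diff A B #> g) \<in> K_finite_sets G K"
    using assms g by (metis K_finite_sym_diff almost_invariant_def)
qed

text \<open>Addition is the symmetric difference, so this is the coset of \<open>A\<close> in the quotient by the
  \<open>K\<close>-finite sets.\<close>

definition end_class :: "'g set \<Rightarrow> 'g set set" where
  "end_class A = (\<lambda>F. sym_diff F A) ` K_finite_sets G K"

lemma mem_end_class: "B \<in> end_class A \<longleftrightarrow> sym_diff B A \<in> K_finite_sets G K"
proof
  assume "B \<in> end_class A"
  then obtain F where "F \<in> K_finite_sets G K" "B = sym_diff F A"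
    by (auto simp: end_class_def)
  moreover from this have "sym_diff B A = F"
    by auto
  ultimately show "sym_diff B A \<in> K_finite_sets G K"
    by simp
next
  assume "sym_diff B A \<in> K_finite_sets G K"
  moreover have "B = sym_diff (sym_diff B A) A"
    by auto
  ultimately show "B \<in> end_class A"
    unfolding end_class_def by blast
qed

lemma end_class_eq_iff: "end_class A = end_class B \<longleftrightarrow> sym_diff A B \<in> K_finite_sets G K"
proof
  assume "end_class A = end_class B"
  moreover have "A \<in> end_class A"
    by (simp add: mem_end_class K_finite_empty)
  ultimately show "sym_diff A B \<in> K_finite_sets G K"
    using mem_end_class by blast
next
  assume AB: "sym_diff A B \<in> K_finite_sets G K"
  have "sym_diff C A \<in> K_finite_sets G K \<longleftrightarrow> sym_diff C B \<in> K_finite_sets G K" for C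
  proof -
    have "sym_diff C A = sym_diff (sym_diff C B) (sym_diff A B)"
         "sym_diff C B = sym_diff (sym_diff C A) (sym_diff A B)"
      by auto
    then show ?thesis
      using AB K_finite_sym_diff by metis
  qed
  then show "end_class A = end_class B"
    using mem_end_class by blast
qed

lemma end_class_empty: "end_class {} = K_finite_sets G K"
  by (auto simp: end_class_def)

definition end_space :: "(int, 'g set set) module" where
  "end_space = (end_module G K)\<lparr>carrier := end_module_fixed G K\<rparr>"

text \<open>A class is fixed by \<open>g\<close> iff \<open>A g\<close> lies in it, because right translation by \<open>g\<close> maps the
  class of \<open>A\<close> onto the class of \<open>A g\<close>. It maps into that class, and applying this to the inverse
  of \<open>g\<close> gives surjectivity.\<close>

lemma carrier_end_space: "carrier end_space = end_class ` Collect almost_invariant"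
proof -
  have 1: "carrier (end_module G K) = end_class ` {A. left_invariant A}"
    by (simp add: end_module_def quot_module_def power_module_def A_RCOSETS_def RCOSETS_def
        r_coset_def end_class_def left_invariant_iff UNION_singleton_eq_range)
  have 2: "(\<lambda>B. B #> g) ` end_class A = end_class (A #> g)"
    if A: "left_invariant A" and g: "g \<in> carrier G" for A g
  proof -
    have *: "(\<lambda>B. B #> h) ` end_class C \<subseteq> end_class (C #> h)"
      if "left_invariant C" "h \<in> carrier G" for C h
    proof clarify
      fix B assume "B \<in> end_class C"
      then obtain F where F: "F \<in> K_finite_sets G K" "B = sym_diff F C"
        by (auto simp: end_class_def)
      then have "B #> h = sym_diff (F #> h) (C #> h)"
        using that K_finite_iff by (simp add: r_coset_sym_diff left_invariant_def)
      then show "B #> h \<in> end_class (C #> h)"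
        using F that K_finite_r_coset unfolding end_class_def by blast
    qed
    have inv_act: "B #> h #> inv h = B" if "B \<subseteq> carrier G" "h \<in> carrier G" for B h
      using that by (simp add: coset_mult_assoc)
    have "B \<in> (\<lambda>B. B #> g) ` end_class A" if B: "B \<in> end_class (A #> g)" for B
    proof -
      have "B #> inv g \<in> end_class (A #> g #> inv g)"
        using *[of "A #> g" "inv g"] A g B left_invariant_r_coset by blast
      then have "B #> inv g \<in> end_class A"
        using A g by (simp add: inv_act left_invariant_def)
      moreover have "B = B #> inv g #> g"
      proof -
        have "B \<subseteq> carrier G"
          using B A g left_invariant_r_coset[OF A g] K_finite_iff
          unfolding end_class_def left_invariant_def by blast
        then show ?thesis
          using inv_act[of B "inv g"] g by simp
      qed
      ultimately show ?thesis
        by blast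
    qed
    then show ?thesis
      using *[OF A g] by blast
  qed
  have "X \<in> end_module_fixed G K \<longleftrightarrow> X \<in> end_class ` Collect almost_invariant" for X
  proof -
    have "(\<forall>g\<in>carrier G. (\<lambda>B. B #> g) ` end_class A = end_class A) \<longleftrightarrow> almost_invariant A"
      if "left_invariant A" for A
    proof -
      have "end_class (A #> g) = end_class A \<longleftrightarrow> sym_diff A (A #> g) \<in> K_finite_sets G K" for g
        using end_class_eq_iff by metis
      then show ?thesis
        using that by (simp add: 2 almost_invariant_def)
    qed
    then show ?thesis
      unfolding end_module_fixed_def 1 by (smt (verit) almost_invariant_def image_iff mem_Collect_eq)
  qed
  then show ?thesis
    by (auto simp: end_space_def)
qed

lemma end_space_zero: "\<zero>\<^bsub>end_space\<^esub> = end_class {}"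
  by (simp add: end_space_def end_module_def quot_module_def end_class_empty)

lemma end_space_add: "end_class A \<oplus>\<^bsub>end_space\<^esub> end_class B = end_class (sym_diff A B)"
proof -
  have "end_class A \<oplus>\<^bsub>end_space\<^esub> end_class B =
      (\<Union>X\<in>end_class A. \<Union>Y\<in>end_class B. {sym_diff X Y})"
    by (simp add: end_space_def end_module_def quot_module_def set_add_def set_mult_def
        power_module_def)
  also have "\<dots> = end_class (sym_diff A B)"
  proof (intro equalityI subsetI)
    fix C assume "C \<in> (\<Union>X\<in>end_class A. \<Union>Y\<in>end_class B. {sym_diff X Y})"
    then obtain X Y where "C = sym_diff X Y"
      and XY: "sym_diff X A \<in> K_finite_sets G K" "sym_diff Y B \<in> K_finite_sets G K"
      by (auto simp: mem_end_class)
    have "sym_diff (sym_diff X Y) (sym_diff A B) = sym_diff (sym_diff X A) (sym_diff Y B)"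
      by blast
    then show "C \<in> end_class (sym_diff A B)"
      using K_finite_sym_diff[OF XY] \<open>C = _\<close> by (simp only: mem_end_class)
  next
    fix C assume C: "C \<in> end_class (sym_diff A B)"
    have "sym_diff (sym_diff C B) A = sym_diff C (sym_diff A B)"
      by auto
    then have "sym_diff C B \<in> end_class A"
      using C by (simp only: mem_end_class)
    moreover have "B \<in> end_class B"
      by (simp add: mem_end_class K_finite_empty)
    moreover have "C = sym_diff (sym_diff C B) B"
      by auto
    ultimately show "C \<in> (\<Union>X\<in>end_class A. \<Union>Y\<in>end_class B. {sym_diff X Y})"
      by blast
  qed
  finally show ?thesis .
qed

lemma end_space_smult:
  "a \<odot>\<^bsub>end_space\<^esub> end_class A = (if a = 0 then end_class {} else end_class A)"
proof -
  have eq: "a \<odot>\<^bsub>end_space\<^esub> end_class A =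
      (\<Union>X\<in>end_class A. end_class (if a = 0 then {} else X))"
    by (simp add: end_space_def end_module_def quot_module_def power_module_def a_r_coset_def
        r_coset_def end_class_def UNION_singleton_eq_range)
  have ne: "A \<in> end_class A"
    by (simp add: mem_end_class K_finite_empty)
  have "end_class X = end_class A" if "X \<in> end_class A" for X
    using that end_class_eq_iff mem_end_class by blast
  then have "(\<Union>X\<in>end_class A. end_class X) = (\<Union>X\<in>end_class A. end_class A)"
    by (rule SUP_cong[OF refl])
  moreover have "(\<Union>X\<in>end_class A. end_class B) = end_class B" for B
    using ne by auto
  ultimately show ?thesis
    by (simp add: eq)
qed

lemma field_two: "field (residue_ring 2)"
proof -
  interpret residues_prime 2 "residue_ring 2"
    by unfold_locales (auto simp: two_is_prime_nat)
  show ?thesis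
    by (rule is_field)
qed

lemma vectorspace_end_space: "vectorspace (residue_ring 2) end_space"
proof (intro vectorspace.intro field_two moduleI)
  show "cring (residue_ring 2)"
    using field_two by (simp add: field.is_ring fieldE(1))
  have assoc: "sym_diff (sym_diff A B) C = sym_diff A (sym_diff B C)" for A B C :: "'g set"
    by blast
  show "abelian_group end_space"
  proof (rule abelian_groupI)
    fix X Y Z
    assume "X \<in> carrier end_space" "Y \<in> carrier end_space" "Z \<in> carrier end_space"
    then obtain A B C where "X = end_class A" "Y = end_class B" "Z = end_class C"
      by (auto simp: carrier_end_space)
    then show "X \<oplus>\<^bsub>end_space\<^esub> Y \<oplus>\<^bsub>end_space\<^esub> Z = X \<oplus>\<^bsub>end_space\<^esub> (Y \<oplus>\<^bsub>end_space\<^esub> Z)"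
      by (simp only: end_space_add assoc)
  next
    fix X Y
    assume "X \<in> carrier end_space" "Y \<in> carrier end_space"
    then obtain A B where AB: "X = end_class A" "Y = end_class B" "almost_invariant A" "almost_invariant B"
      by (auto simp: carrier_end_space)
    then show "X \<oplus>\<^bsub>end_space\<^esub> Y \<in> carrier end_space"
      unfolding carrier_end_space AB(1,2) end_space_add using almost_invariant_sym_diff by blast
    show "X \<oplus>\<^bsub>end_space\<^esub> Y = Y \<oplus>\<^bsub>end_space\<^esub> X"
      by (simp only: AB end_space_add Un_commute)
  next
    fix X assume "X \<in> carrier end_space"
    then obtain A where A: "X = end_class A" "almost_invariant A"
      by (auto simp: carrier_end_space)
    show "\<zero>\<^bsub>end_space\<^esub> \<oplus>\<^bsub>end_space\<^esub> X = X"
      by (simp add: A end_space_zero end_space_add)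
    have "X \<oplus>\<^bsub>end_space\<^esub> X = \<zero>\<^bsub>end_space\<^esub>"
      by (simp add: A end_space_zero end_space_add)
    then show "\<exists>Y\<in>carrier end_space. Y \<oplus>\<^bsub>end_space\<^esub> X = \<zero>\<^bsub>end_space\<^esub>"
      using A carrier_end_space by blast
  next
    show "\<zero>\<^bsub>end_space\<^esub> \<in> carrier end_space"
      unfolding carrier_end_space end_space_zero
      using K_finite_almost_invariant K_finite_empty by blast
  qed
next
  fix a b :: int and X
  assume a: "a \<in> carrier (residue_ring 2)" and b: "b \<in> carrier (residue_ring 2)"
    and "X \<in> carrier end_space"
  then obtain A where A: "X = end_class A" "almost_invariant A"
    by (auto simp: carrier_end_space)
  have ab: "a = 0 \<or> a = 1" "b = 0 \<or> b = 1"
    using a b by (auto simp: residue_ring_def)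
  show "(a \<oplus>\<^bsub>residue_ring 2\<^esub> b) \<odot>\<^bsub>end_space\<^esub> X = a \<odot>\<^bsub>end_space\<^esub> X \<oplus>\<^bsub>end_space\<^esub> b \<odot>\<^bsub>end_space\<^esub> X"
    using ab by (auto simp: A end_space_smult end_space_add residue_ring_def)
  show "(a \<otimes>\<^bsub>residue_ring 2\<^esub> b) \<odot>\<^bsub>end_space\<^esub> X = a \<odot>\<^bsub>end_space\<^esub> (b \<odot>\<^bsub>end_space\<^esub> X)"
    using ab by (auto simp: A end_space_smult residue_ring_def)
next
  fix a :: int and X Y
  assume "a \<in> carrier (residue_ring 2)" "X \<in> carrier end_space" "Y \<in> carrier end_space"
  then obtain A B where AB: "X = end_class A" "Y = end_class B"
    by (auto simp: carrier_end_space)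
  show "a \<odot>\<^bsub>end_space\<^esub> (X \<oplus>\<^bsub>end_space\<^esub> Y) = a \<odot>\<^bsub>end_space\<^esub> X \<oplus>\<^bsub>end_space\<^esub> a \<odot>\<^bsub>end_space\<^esub> Y"
    by (simp add: AB end_space_smult end_space_add)
next
  fix a :: int and X
  assume "X \<in> carrier end_space"
  then obtain A where A: "X = end_class A" "almost_invariant A"
    by (auto simp: carrier_end_space)
  show "\<one>\<^bsub>residue_ring 2\<^esub> \<odot>\<^bsub>end_space\<^esub> X = X"
    by (simp add: A end_space_smult residue_ring_def)
  show "a \<odot>\<^bsub>end_space\<^esub> X \<in> carrier end_space"
    using A K_finite_almost_invariant[OF K_finite_empty]
    by (simp add: end_space_smult carrier_end_space)
qed

text \<open>Over the field with two elements the line spanned by the class \<open>u\<close> of the whole group has the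
  elements \<open>0\<close> and \<open>u\<close> only, that is, the classes of the \<open>K\<close>-finite sets and of their complements.
  Any further class is linearly independent of \<open>u\<close>.\<close>

lemma ends_gt_one_iff:
  "ends G K > 1 \<longleftrightarrow>
     (\<exists>A. almost_invariant A \<and> A \<notin> K_finite_sets G K \<and> carrier G - A \<notin> K_finite_sets G K)"
proof -
  interpret V: vectorspace "residue_ring 2" end_space
    by (rule vectorspace_end_space)
  have ends: "ends G K = (if V.fin_dim then enat V.dim else \<infinity>)"
    by (simp add: ends_def edim_def end_space_def)
  define u where "u = end_class (carrier G)"
  have u: "u \<in> carrier end_space"
    using almost_invariant_carrier by (simp add: u_def carrier_end_space)
  have zero_iff: "end_class A = \<zero>\<^bsub>end_space\<^esub> \<longleftrightarrow> A \<in> K_finite_sets G K" for A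
    by (simp add: end_space_zero end_class_eq_iff)
  have u_iff: "end_class A = u \<longleftrightarrow> carrier G - A \<in> K_finite_sets G K" if "almost_invariant A" for A
  proof -
    have "sym_diff A (carrier G) = carrier G - A"
      using that by (auto simp: almost_invariant_def left_invariant_def)
    then show ?thesis
      by (simp add: u_def end_class_eq_iff)
  qed
  show ?thesis
  proof
    assume gt: "ends G K > 1"
    show "\<exists>A. almost_invariant A \<and> A \<notin> K_finite_sets G K \<and> carrier G - A \<notin> K_finite_sets G K"
    proof (rule ccontr)
      assume none: "\<not> ?thesis"
      have "X \<in> V.span {u}" if X: "X \<in> carrier end_space" for X
      proof -
        obtain A where A: "X = end_class A" "almost_invariant A"
          using X by (auto simp: carrier_end_space)
        then have "X = \<zero>\<^bsub>end_space\<^esub> \<or> X = u"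
          using none zero_iff u_iff by blast
        moreover have "u \<in> V.span {u}"
          using V.in_own_span[of "{u}"] u by simp
        moreover have "\<zero>\<^bsub>end_space\<^esub> \<in> V.span {u}"
          using V.span_is_submodule[of "{u}"] u by (simp add: submodule.zero_closed)
        ultimately show ?thesis
          by blast
      qed
      then have gen: "V.gen_set {u}"
        using V.span_is_subset2[of "{u}"] u by auto
      have "V.dim \<le> card {u}"
        using V.gen_ge_dim[of "{u}"] u gen by simp
      moreover have "V.fin_dim"
        using gen u unfolding V.fin_dim_def by (intro exI[of _ "{u}"]) auto
      ultimately show False
        using gt ends by (simp add: one_enat_def)
    qed
  next
    assume "\<exists>A. almost_invariant A \<and> A \<notin> K_finite_sets G K \<and> carrier G - A \<notin> K_finite_sets G K"
    then obtain A where A: "almost_invariant A" "A \<notin> K_finite_sets G K"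
      "carrier G - A \<notin> K_finite_sets G K"
      by blast
    define v where "v = end_class A"
    have v: "v \<in> carrier end_space" "v \<noteq> u" "v \<noteq> \<zero>\<^bsub>end_space\<^esub>"
      using A u_iff zero_iff by (auto simp: v_def carrier_end_space)
    \<comment> \<open>If the whole group were \<open>K\<close>-finite, then so would be \<open>A\<close>.\<close>
    have u0: "u \<noteq> \<zero>\<^bsub>end_space\<^esub>"
    proof
      assume "u = \<zero>\<^bsub>end_space\<^esub>"
      then have "carrier G \<in> K_finite_sets G K"
        using zero_iff by (simp add: u_def)
      then show False
        using A K_finite_subset by (auto simp: almost_invariant_def left_invariant_def)
    qed
    have smult: "a \<odot>\<^bsub>end_space\<^esub> w = (if a = 0 then \<zero>\<^bsub>end_space\<^esub> else w)"
      if "w \<in> carrier end_space" for a w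
      using that by (auto simp: carrier_end_space end_space_smult end_space_zero)
    have double: "w \<oplus>\<^bsub>end_space\<^esub> w = \<zero>\<^bsub>end_space\<^esub>" if "w \<in> carrier end_space" for w
      using that by (auto simp: carrier_end_space end_space_add end_space_zero)
    have "V.lin_indpt {u, v}"
    proof
      assume "V.lin_dep {u, v}"
      then obtain a w where a: "a \<in> {u, v} \<rightarrow> carrier (residue_ring 2)"
          "V.lincomb a {u, v} = \<zero>\<^bsub>end_space\<^esub>" "w \<in> {u, v}" "a w \<noteq> \<zero>\<^bsub>residue_ring 2\<^esub>"
        using V.finite_lin_dep[of "{u, v}"] u v(1) by auto
      have "V.lincomb a {u, v} = a u \<odot>\<^bsub>end_space\<^esub> u \<oplus>\<^bsub>end_space\<^esub> V.lincomb a ({u, v} - {u})"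
        using a u v(1) by (intro V.lincomb_del2) auto
      also have "{u, v} - {u} = {v}"
        using v by auto
      also have "V.lincomb a {v} = a v \<odot>\<^bsub>end_space\<^esub> v"
        using a(1) v(1) by (simp add: V.lincomb_def Pi_def)
      finally have *: "a u \<odot>\<^bsub>end_space\<^esub> u \<oplus>\<^bsub>end_space\<^esub> a v \<odot>\<^bsub>end_space\<^esub> v = \<zero>\<^bsub>end_space\<^esub>"
        using a(2) by simp
      have "a u \<noteq> 0 \<or> a v \<noteq> 0"
        using a by (auto simp: residue_ring_def)
      then consider "a u \<noteq> 0" "a v = 0" | "a u = 0" "a v \<noteq> 0" | "a u \<noteq> 0" "a v \<noteq> 0"
        by blast
      then show False
      proof cases
        case 3
        then have "u \<oplus>\<^bsub>end_space\<^esub> v = v \<oplus>\<^bsub>end_space\<^esub> v"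
          using * u v double by (simp add: smult)
        then show False
          using u v by simp
      qed (use * u v u0 in \<open>simp_all add: smult\<close>)
    qed
    then have "card {u, v} \<le> V.dim" if V.fin_dim
      using V.li_le_dim(2)[OF that, of "{u, v}"] u v by simp
    then show "ends G K > 1"
      using v(2) by (auto simp: ends one_enat_def)
  qed
qed

lemma r_coset_eq_iff:
  assumes "g \<in> carrier G" "h \<in> carrier G"
  shows "K #> g = K #> h \<longleftrightarrow> g \<otimes> inv h \<in> K"
proof
  assume eq: "K #> g = K #> h"
  have "g \<in> K #> g"
    using assms K.subgroup_axioms by (intro rcos_self)
  then show "g \<otimes> inv h \<in> K"
    using assms eq by (simp add: K.rcos_module is_group)
next
  assume "g \<otimes> inv h \<in> K"
  then have "g \<in> K #> h"
    using assms by (simp add: K.rcos_module is_group)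
  then show "K #> g = K #> h"
    using assms K.subgroup_axioms by (metis repr_independence)
qed

text \<open>Such an \<open>f\<close> is a bijection between the right cosets of \<open>K\<close> and its values; it will be
  the map taking \<open>g\<close> to the translate by the inverse of \<open>g\<close> of an object with stabilizer \<open>K\<close>.\<close>

lemma K_finite_iff_finite_image:
  assumes R: "left_invariant R"
    and f: "\<And>g h. \<lbrakk>g \<in> carrier G; h \<in> carrier G\<rbrakk> \<Longrightarrow> f g = f h \<longleftrightarrow> g \<otimes> inv h \<in> K"
  shows "R \<in> K_finite_sets G K \<longleftrightarrow> finite (f ` R)"
proof -
  have RG: "R \<subseteq> carrier G"
    using R by (simp add: left_invariant_def)
  have eq: "f g = f h \<longleftrightarrow> K #> g = K #> h" if "g \<in> R" "h \<in> R" for g h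
    using that RG by (simp add: f r_coset_eq_iff subset_iff)
  have "bij_betw (\<lambda>y. K #> inv_into R f y) (f ` R) ((#>) K ` R)"
  proof (rule bij_betw_imageI)
    show "inj_on (\<lambda>y. K #> inv_into R f y) (f ` R)"
      by (rule inj_onI) (metis eq f_inv_into_f inv_into_into)
    have "K #> inv_into R f (f g) = K #> g" if "g \<in> R" for g
      using that eq by (metis f_inv_into_f imageI inv_into_into)
    then show "(\<lambda>y. K #> inv_into R f y) ` f ` R = (#>) K ` R"
      by (simp add: image_image cong: image_cong_simp)
  qed
  then show ?thesis
    using R bij_betw_finite by (auto simp: K_finite_iff)
qed

text \<open>Almost invariance as a finiteness statement about pairs: modulo \<open>K\<close> there are only finitely
  many \<open>h\<close> in \<open>A\<close> that right multiplication by \<open>z\<close> throws out of \<open>A\<close>.\<close>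

lemma crossing_representatives:
  assumes A: "almost_invariant A" and z: "z \<in> carrier G"
  obtains F where "F \<subseteq> carrier G" "finite F"
    "\<And>h. \<lbrakk>h \<in> A; h \<otimes> z \<notin> A\<rbrakk> \<Longrightarrow> \<exists>k\<in>K. \<exists>f\<in>F. h = k \<otimes> f"
proof -
  have AG: "A \<subseteq> carrier G"
    using A by (simp add: almost_invariant_def left_invariant_def)
  have "sym_diff A (A #> inv z) \<in> K_finite_sets G K"
    using A z by (simp add: almost_invariant_def)
  then obtain F where F: "F \<subseteq> carrier G" "finite F" "sym_diff A (A #> inv z) = K <#> F"
    by (auto simp: K_finite_sets_def)
  show thesis
  proof (rule that[OF F(1,2)])
    fix h assume h: "h \<in> A" "h \<otimes> z \<notin> A"
    have "h \<notin> A #> inv z"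
    proof
      assume "h \<in> A #> inv z"
      then obtain a where a: "a \<in> A" "h = a \<otimes> inv z"
        by (auto simp: r_coset_def)
      then have "h \<otimes> z = a"
        using z AG by (auto simp: m_assoc)
      then show False
        using a h by simp
    qed
    then have "h \<in> K <#> F"
      using h F(3) by blast
    then show "\<exists>k\<in>K. \<exists>f\<in>F. h = k \<otimes> f"
      by (auto simp: set_mult_def)
  qed
qed

end

section \<open>Half spaces and group actions\<close>

context median_algebra
begin

lemma median_in_interval:
  assumes "x \<in> M" "y \<in> M" "z \<in> M"
  shows "m x y z \<in> med_interval M m x y" "m x y z \<in> med_interval M m y z"
proof -
  have *: "m x y z = m x y (m x y z)" if "x \<in> M" "y \<in> M" "z \<in> M" for x y z
  proof -
    have "m x y (m x y z) = m (m z x y) x y"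
      using that by (metis closed rotate)
    also have "\<dots> = m z (m x x y) (m y x y)"
      using that distrib by blast
    also have "\<dots> = m z x y"
      using that by (metis majority rotate)
    finally show ?thesis
      using that by (metis rotate)
  qed
  show "m x y z \<in> med_interval M m x y"
    using *[OF assms] assms closed by (simp add: med_interval_def)
  show "m x y z \<in> med_interval M m y z"
    using *[of y z x] assms closed by (simp add: med_interval_def rotate[of x y z])
qed

lemma half_space_complement: "half_space M m H \<Longrightarrow> half_space M m (M - H)"
  by (auto simp: half_space_def double_diff)

lemma half_space_subset: "half_space M m H \<Longrightarrow> H \<subseteq> M"
  by (simp add: half_space_def)

lemma half_space_interval:
  "\<lbrakk>half_space M m H; x \<in> H; y \<in> H; w \<in> med_interval M m x y\<rbrakk> \<Longrightarrow> w \<in> H"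
  by (auto simp: half_space_def med_convex_def)

text \<open>A nearest point of a convex set is a gate: if a half space around \<open>y\<close> that misses \<open>z\<close> contained
  a point \<open>w\<close> of \<open>C\<close>, the median of \<open>w\<close>, \<open>y\<close> and \<open>z\<close> would lie in \<open>C\<close> and be nearer to \<open>y\<close> than \<open>z\<close>.\<close>

lemma nearest_point_separation:
  assumes disc: "med_discrete M m" and C: "med_convex M m C"
    and y: "y \<in> M" and z: "z \<in> C"
    and nearest: "\<And>w. w \<in> C \<Longrightarrow> med_dist M m y z \<le> med_dist M m y w"
    and J: "J \<in> separating M m y z"
  shows "J \<inter> C = {}"
proof (rule ccontr)
  assume "J \<inter> C \<noteq> {}"
  then obtain w where w: "w \<in> J" "w \<in> C"
    by blast
  have inM: "z \<in> M" "w \<in> M"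
    using C z w by (auto simp: med_convex_def)
  have hJ: "half_space M m J" "y \<in> J" "z \<notin> J"
    using J by (auto simp: separating_def)
  define v where "v = m w y z"
  have v: "v \<in> med_interval M m w y" "v \<in> med_interval M m y z" "v \<in> med_interval M m z w"
    using median_in_interval[of w y z] median_in_interval[of z w y] inM y
    unfolding v_def by (metis rotate)+
  have "v \<in> J"
    using half_space_interval hJ w v by blast
  moreover have "v \<in> C"
    using C v(3) z w by (auto simp: med_convex_def)
  moreover have "separating M m y v \<subseteq> separating M m y z"
    using half_space_interval v(2) by (auto simp: separating_def)
  ultimately have "separating M m y v \<subset> separating M m y z"
    using J by (auto simp: separating_def)
  moreover have "finite (separating M m y z)"
    using disc y inM by (simp add: med_discrete_def)
  ultimately have "med_dist M m y v < med_dist M m y z"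
    unfolding med_dist_def by (rule psubset_card_mono[rotated])
  then show False
    using nearest[OF \<open>v \<in> C\<close>] by simp
qed

end

sublocale median_action \<subseteq> G: group G
  using group_hom group_hom.axioms(1) by blast

context median_action
begin

lemma act_closed: "\<lbrakk>g \<in> carrier G; x \<in> M\<rbrakk> \<Longrightarrow> \<phi> g x \<in> M"
  using element_image by blast

lemma act_inv_act: "\<lbrakk>g \<in> carrier G; x \<in> M\<rbrakk> \<Longrightarrow> \<phi> (inv\<^bsub>G\<^esub> g) (\<phi> g x) = x"
  using orbit_sym_aux by blast

lemma act_act_inv: "\<lbrakk>g \<in> carrier G; x \<in> M\<rbrakk> \<Longrightarrow> \<phi> g (\<phi> (inv\<^bsub>G\<^esub> g) x) = x"
  using act_inv_act[of "inv\<^bsub>G\<^esub> g" x] by simp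

lemma set_act_mult:
  assumes "g \<in> carrier G" "h \<in> carrier G" "H \<subseteq> M"
  shows "set_act \<phi> (g \<otimes>\<^bsub>G\<^esub> h) H = set_act \<phi> g (set_act \<phi> h H)"
  unfolding image_image using assms composition_rule by (intro image_cong) auto

lemma act_one: "x \<in> M \<Longrightarrow> \<phi> \<one>\<^bsub>G\<^esub> x = x"
  using id_eq_one by (metis restrict_apply')

lemma set_act_one:
  assumes "H \<subseteq> M"
  shows "set_act \<phi> \<one>\<^bsub>G\<^esub> H = H"
proof -
  have "set_act \<phi> \<one>\<^bsub>G\<^esub> H = (\<lambda>x. x) ` H"
    using assms act_one by (intro image_cong) auto
  then show ?thesis
    by simp
qed

lemma set_act_inv:
  assumes "g \<in> carrier G" "H \<subseteq> M"
  shows "set_act \<phi> (inv\<^bsub>G\<^esub> g) (set_act \<phi> g H) = H"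
proof -
  have "set_act \<phi> (inv\<^bsub>G\<^esub> g) (set_act \<phi> g H) = set_act \<phi> (inv\<^bsub>G\<^esub> g \<otimes>\<^bsub>G\<^esub> g) H"
    using assms by (simp only: set_act_mult G.inv_closed)
  also have "\<dots> = H"
    using assms by (simp only: set_act_one G.l_inv)
  finally show ?thesis .
qed

lemma mem_set_act:
  assumes "g \<in> carrier G" "H \<subseteq> M" "x \<in> M"
  shows "x \<in> set_act \<phi> g H \<longleftrightarrow> \<phi> (inv\<^bsub>G\<^esub> g) x \<in> H"
proof
  assume "x \<in> set_act \<phi> g H"
  then obtain y where "y \<in> H" "x = \<phi> g y"
    by blast
  then show "\<phi> (inv\<^bsub>G\<^esub> g) x \<in> H"
    using assms act_inv_act[of g y] by auto
next
  assume "\<phi> (inv\<^bsub>G\<^esub> g) x \<in> H"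
  moreover have "x = \<phi> g (\<phi> (inv\<^bsub>G\<^esub> g) x)"
    using assms by (simp add: act_act_inv)
  ultimately show "x \<in> set_act \<phi> g H"
    by blast
qed

lemma act_mem_set_act:
  assumes "g \<in> carrier G" "H \<subseteq> M" "x \<in> M"
  shows "\<phi> g x \<in> set_act \<phi> g H \<longleftrightarrow> x \<in> H"
  using assms act_inv_act act_closed mem_set_act by simp

lemma set_act_subset: "\<lbrakk>g \<in> carrier G; H \<subseteq> M\<rbrakk> \<Longrightarrow> set_act \<phi> g H \<subseteq> M"
  using act_closed by blast

lemma set_act_Diff:
  "\<lbrakk>g \<in> carrier G; H \<subseteq> M\<rbrakk> \<Longrightarrow> set_act \<phi> g (M - H) = M - set_act \<phi> g H"
  using inj_prop[of g] surj_prop[of g] by (simp add: inj_on_image_set_diff)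

lemma half_space_set_act:
  assumes "g \<in> carrier G" "half_space M m H"
  shows "half_space M m (set_act \<phi> g H)"
proof -
  have convex: "med_convex M m (set_act \<phi> g C)" if "med_convex M m C" for C
    unfolding med_convex_def
  proof (intro conjI ballI subsetI)
    have C: "C \<subseteq> M"
      using that by (simp add: med_convex_def)
    then show "w \<in> M" if "w \<in> set_act \<phi> g C" for w
      using that assms(1) act_closed by blast
    fix x y w
    assume x: "x \<in> set_act \<phi> g C" and y: "y \<in> set_act \<phi> g C" and w: "w \<in> med_interval M m x y"
    have M: "x \<in> M" "y \<in> M" "w \<in> M" "w = m x y w"
      using x y w set_act_subset[OF assms(1) C] by (auto simp: med_interval_def)
    have "\<phi> (inv\<^bsub>G\<^esub> g) w = m (\<phi> (inv\<^bsub>G\<^esub> g) x) (\<phi> (inv\<^bsub>G\<^esub> g) y) (\<phi> (inv\<^bsub>G\<^esub> g) w)"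
      using M equivariant assms(1) G.inv_closed by metis
    then have "\<phi> (inv\<^bsub>G\<^esub> g) w \<in> med_interval M m (\<phi> (inv\<^bsub>G\<^esub> g) x) (\<phi> (inv\<^bsub>G\<^esub> g) y)"
      using M assms(1) act_closed by (simp add: med_interval_def)
    then show "w \<in> set_act \<phi> g C"
      using that x y M C assms(1) by (auto simp: mem_set_act med_convex_def)
  qed
  have "M - set_act \<phi> g H = set_act \<phi> g (M - H)"
    using assms half_space_subset by (simp add: set_act_Diff)
  then show ?thesis
    using assms convex set_act_subset by (simp add: half_space_def)
qed

lemma separating_act:
  assumes "g \<in> carrier G" "x \<in> M" "y \<in> M"
  shows "separating M m (\<phi> g x) (\<phi> g y) = set_act \<phi> g ` separating M m x y"
proof -
  have sub: "set_act \<phi> h ` separating M m a b \<subseteq> separating M m (\<phi> h a) (\<phi> h b)"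
    if "h \<in> carrier G" "a \<in> M" "b \<in> M" for h a b
  proof clarify
    fix J assume "J \<in> separating M m a b"
    then have J: "half_space M m J" "a \<in> J" "b \<notin> J"
      by (auto simp: separating_def)
    moreover have "\<phi> h b \<notin> set_act \<phi> h J"
      using act_mem_set_act[OF that(1) half_space_subset[OF J(1)] that(3)] J(3) by blast
    ultimately show "set_act \<phi> h J \<in> separating M m (\<phi> h a) (\<phi> h b)"
      using half_space_set_act[OF that(1) J(1)] by (simp add: separating_def)
  qed
  have "J \<in> set_act \<phi> g ` separating M m x y" if J: "J \<in> separating M m (\<phi> g x) (\<phi> g y)" for J
  proof
    have JM: "J \<subseteq> M"
      using J half_space_subset by (simp add: separating_def)
    have "set_act \<phi> (inv\<^bsub>G\<^esub> g) ` separating M m (\<phi> g x) (\<phi> g y) \<subseteq> separating M m x y"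
      using sub[of "inv\<^bsub>G\<^esub> g" "\<phi> g x" "\<phi> g y"] assms by (simp add: act_inv_act act_closed)
    then show "set_act \<phi> (inv\<^bsub>G\<^esub> g) J \<in> separating M m x y"
      using J by blast
    show "J = set_act \<phi> g (set_act \<phi> (inv\<^bsub>G\<^esub> g) J)"
      using set_act_inv[of "inv\<^bsub>G\<^esub> g" J] assms JM by simp
  qed
  then show ?thesis
    using sub[OF assms] by (intro equalityI subsetI) (simp_all only: subset_iff)
qed

lemma med_dist_act:
  assumes "g \<in> carrier G" "x \<in> M" "y \<in> M"
  shows "med_dist M m (\<phi> g x) (\<phi> g y) = med_dist M m x y"
proof -
  have "inj_on (set_act \<phi> g) (separating M m x y)"
  proof (rule inj_onI)
    fix H J assume "H \<in> separating M m x y" "J \<in> separating M m x y" "set_act \<phi> g H = set_act \<phi> g J"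
    then show "H = J"
      using set_act_inv[OF assms(1)] half_space_subset by (metis (lifting) mem_Collect_eq separating_def)
  qed
  then show ?thesis
    using assms by (simp add: med_dist_def separating_act card_image)
qed

lemma orbit_set_actE:
  assumes "J \<in> orbit G (set_act \<phi>) H"
  obtains g where "g \<in> carrier G" "J = set_act \<phi> g H"
  using assms by (auto simp: orbit_def)

lemma orbit_subset: "\<lbrakk>H \<subseteq> M; J \<in> orbit G (set_act \<phi>) H\<rbrakk> \<Longrightarrow> J \<subseteq> M"
  using act_closed by (auto simp: orbit_def)

lemma orbit_half_space:
  "\<lbrakk>half_space M m H; J \<in> orbit G (set_act \<phi>) H\<rbrakk> \<Longrightarrow> half_space M m J"
  using half_space_set_act by (auto simp: orbit_def)

lemma set_act_orbit:
  assumes "H \<subseteq> M" "g \<in> carrier G" "J \<in> orbit G (set_act \<phi>) H"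
  shows "set_act \<phi> g J \<in> orbit G (set_act \<phi>) H"
proof -
  obtain h where h: "h \<in> carrier G" "J = set_act \<phi> h H"
    using assms(3) by (rule orbit_set_actE)
  then have "set_act \<phi> g J = set_act \<phi> (g \<otimes>\<^bsub>G\<^esub> h) H"
    using assms by (simp only: set_act_mult)
  then show ?thesis
    using assms(2) h(1) by (auto simp: orbit_def)
qed

section \<open>Translates of a half space around a point\<close>

definition translates_at :: "'m set \<Rightarrow> 'm \<Rightarrow> 'm set set" where
  "translates_at H x = {J \<in> orbit G (set_act \<phi>) H. x \<in> J}"

lemma orbit_complement:
  assumes "H \<subseteq> M"
  shows "orbit G (set_act \<phi>) (M - H) = (\<lambda>J. M - J) ` orbit G (set_act \<phi>) H"
proof -
  have "orbit G (set_act \<phi>) J = (\<lambda>g. set_act \<phi> g J) ` carrier G" for J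
    by (auto simp: orbit_def)
  then show ?thesis
    using assms by (simp add: image_image set_act_Diff cong: image_cong_simp)
qed

lemma finite_translates_at:
  assumes disc: "med_discrete M m" and H: "half_space M m H"
    and x: "x \<in> M" and y: "y \<in> M" and fin: "finite (translates_at H x)"
  shows "finite (translates_at H y)"
proof (rule finite_subset)
  show "translates_at H y \<subseteq> translates_at H x \<union> separating M m y x"
    using H orbit_half_space by (auto simp: translates_at_def separating_def)
  show "finite (translates_at H x \<union> separating M m y x)"
    using disc x y fin by (simp add: med_discrete_def)
qed

text \<open>In particular the number of translates around a point is constant on orbits.\<close>

lemma bij_betw_translates_at:
  assumes "H \<subseteq> M" "g \<in> carrier G" "x \<in> M"
  shows "bij_betw (set_act \<phi> g) (translates_at H x) (translates_at H (\<phi> g x))"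
proof (rule bij_betw_byWitness[where f' = "set_act \<phi> (inv\<^bsub>G\<^esub> g)"])
  have sub: "J \<subseteq> M" if "J \<in> translates_at H z" for J z
    using that orbit_subset[OF assms(1)] by (simp add: translates_at_def)
  show "\<forall>J\<in>translates_at H x. set_act \<phi> (inv\<^bsub>G\<^esub> g) (set_act \<phi> g J) = J"
    using set_act_inv[OF assms(2) sub] by blast
  show "\<forall>J\<in>translates_at H (\<phi> g x). set_act \<phi> g (set_act \<phi> (inv\<^bsub>G\<^esub> g) J) = J"
    using set_act_inv[OF G.inv_closed[OF assms(2)] sub] assms(2) by simp
  show "set_act \<phi> g ` translates_at H x \<subseteq> translates_at H (\<phi> g x)"
    using set_act_orbit[OF assms(1,2)] by (auto simp: translates_at_def)
  show "set_act \<phi> (inv\<^bsub>G\<^esub> g) ` translates_at H (\<phi> g x) \<subseteq> translates_at H x"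
  proof clarify
    fix J assume "J \<in> translates_at H (\<phi> g x)"
    then have J: "J \<in> orbit G (set_act \<phi>) H" "\<phi> g x \<in> J"
      by (auto simp: translates_at_def)
    have "\<phi> (inv\<^bsub>G\<^esub> g) (\<phi> g x) \<in> set_act \<phi> (inv\<^bsub>G\<^esub> g) J"
      using J(2) by (rule imageI)
    then show "set_act \<phi> (inv\<^bsub>G\<^esub> g) J \<in> translates_at H x"
      using assms set_act_orbit[OF assms(1) _ J(1)] by (simp add: translates_at_def act_inv_act)
  qed
qed

text \<open>Suppose only finitely many translates contain each point. No two translates cover \<open>M\<close>:
  otherwise each of the infinitely many translates that miss \<open>x\<close> would have a covering partner
  among the finitely many that contain \<open>x\<close>; some partner would serve infinitely many translates,
  and these would all contain any point outside the partner. Take \<open>y\<close> in the least number of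
  translates, a translate \<open>J\<close> around \<open>y\<close>, and the nearest point \<open>z\<close> outside \<open>J\<close>. A translate
  containing \<open>z\<close> but not \<open>y\<close> would together with \<open>J\<close> cover \<open>M\<close>. So \<open>z\<close> lies in fewer
  translates than \<open>y\<close>.\<close>

lemma infinite_translates_at_of_meets_orbits:
  assumes disc: "med_discrete M m" and H: "half_space M m H"
    and inf: "infinite (orbit G (set_act \<phi>) H)"
    and meets: "\<And>y. y \<in> M \<Longrightarrow> H \<inter> orbit G \<phi> y \<noteq> {}"
    and x: "x \<in> M"
  shows "infinite (translates_at H x)"
proof
  assume "finite (translates_at H x)"
  then have fin: "finite (translates_at H y)" if "y \<in> M" for y
    using finite_translates_at[OF disc H x that] by blast
  have HM: "H \<subseteq> M"
    using H half_space_subset by blast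
  have subM: "J \<subseteq> M" if "J \<in> orbit G (set_act \<phi>) H" for J
    using that by (rule orbit_subset[OF HM])
  have proper: "J \<noteq> M" if J: "J \<in> orbit G (set_act \<phi>) H" for J
  proof
    assume "J = M"
    then have "M \<in> orbit G (set_act \<phi>) H"
      using J by simp
    then obtain g where g: "g \<in> carrier G" "M = set_act \<phi> g H"
      by (rule orbit_set_actE)
    then have "H = set_act \<phi> (inv\<^bsub>G\<^esub> g) M"
      using set_act_inv[OF g(1) HM] by simp
    also have "\<dots> = M"
      using g(1) by (simp add: surj_prop)
    finally have "set_act \<phi> k H = M" if "k \<in> carrier G" for k
      using surj_prop[OF that] by simp
    then have "orbit G (set_act \<phi>) H \<subseteq> {M}"
      unfolding orbit_def by blast
    then show False
      using inf finite_subset by blast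
  qed
  have no_cover: "J \<union> J' \<noteq> M" if JJ': "J \<in> orbit G (set_act \<phi>) H" "J' \<in> orbit G (set_act \<phi>) H" for J J'
  proof
    assume cover: "J \<union> J' = M"
    have partner: "\<exists>L'\<in>orbit G (set_act \<phi>) H. L \<union> L' = M" if "L \<in> orbit G (set_act \<phi>) H" for L
    proof -
      obtain g where g: "g \<in> carrier G" "J = set_act \<phi> g H"
        using JJ' by (auto elim: orbit_set_actE)
      obtain h where h: "h \<in> carrier G" "L = set_act \<phi> h H"
        using \<open>L \<in> _\<close> by (auto elim: orbit_set_actE)
      define k where "k = h \<otimes>\<^bsub>G\<^esub> inv\<^bsub>G\<^esub> g"
      have k: "k \<in> carrier G"
        using g h by (simp add: k_def)
      have "k \<otimes>\<^bsub>G\<^esub> g = h"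
        using g h by (simp add: k_def G.m_assoc)
      then have "L = set_act \<phi> k J"
        using set_act_mult[OF k g(1) HM] g h by simp
      moreover have "set_act \<phi> k J \<union> set_act \<phi> k J' = M"
        using cover surj_prop[OF k] by (simp flip: image_Un)
      ultimately show ?thesis
        using set_act_orbit[OF HM k JJ'(2)] by blast
    qed
    \<comment> \<open>Infinitely many translates miss \<open>x\<close>; their partners all contain \<open>x\<close>.\<close>
    define N where "N = orbit G (set_act \<phi>) H - translates_at H x"
    have "infinite N"
      using inf fin[OF x] by (simp add: N_def)
    obtain p where p: "\<And>L. L \<in> N \<Longrightarrow> p L \<in> orbit G (set_act \<phi>) H \<and> L \<union> p L = M"
      using partner unfolding N_def by (metis DiffD1)
    have "p ` N \<subseteq> translates_at H x"
      using p x by (auto simp: translates_at_def N_def)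
    then have "finite (p ` N)"
      using fin[OF x] finite_subset by blast
    then obtain L0 where L0: "L0 \<in> N" "infinite {L \<in> N. p L = p L0}"
      using pigeonhole_infinite[OF \<open>infinite N\<close>] by blast
    obtain z where z: "z \<in> M" "z \<notin> p L0"
      using p[OF L0(1)] proper subM by blast
    have "{L \<in> N. p L = p L0} \<subseteq> translates_at H z"
      using p z by (auto simp: translates_at_def N_def)
    then show False
      using L0(2) fin[OF z(1)] finite_subset by blast
  qed
  obtain y where y: "y \<in> M" and y_min: "\<And>z. z \<in> M \<Longrightarrow> card (translates_at H y) \<le> card (translates_at H z)"
    using arg_min_nat_lemma[of "\<lambda>y. y \<in> M" x "\<lambda>y. card (translates_at H y)"] x by blast
  obtain g where g: "g \<in> carrier G" "\<phi> g y \<in> H"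
    using meets[OF y] by (auto simp: orbit_def)
  define J where "J = set_act \<phi> (inv\<^bsub>G\<^esub> g) H"
  have J: "J \<in> orbit G (set_act \<phi>) H" "y \<in> J"
    using g y HM by (auto simp: J_def orbit_def mem_set_act)
  obtain z0 where "z0 \<in> M - J"
    using proper[OF J(1)] subM[OF J(1)] by blast
  then obtain z where z: "z \<in> M - J"
    and z_min: "\<And>w. w \<in> M - J \<Longrightarrow> med_dist M m y z \<le> med_dist M m y w"
    using arg_min_nat_lemma[of "\<lambda>z. z \<in> M - J" z0 "med_dist M m y"] by blast
  have "translates_at H z \<subseteq> translates_at H y"
  proof
    fix L assume L: "L \<in> translates_at H z"
    then have L': "L \<in> orbit G (set_act \<phi>) H" "z \<in> L" "half_space M m L"
      using orbit_half_space[OF H] by (auto simp: translates_at_def)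
    have "y \<in> L"
    proof (rule ccontr)
      assume "y \<notin> L"
      then have "M - L \<in> separating M m y z"
        using L' y half_space_complement by (simp add: separating_def)
      then have "(M - L) \<inter> (M - J) = {}"
        using nearest_point_separation[OF disc _ y z z_min] orbit_half_space[OF H J(1)]
        by (simp add: half_space_def)
      then show False
        using no_cover[OF L'(1) J(1)] subM L'(1) J(1) by blast
    qed
    then show "L \<in> translates_at H y"
      using L' by (simp add: translates_at_def)
  qed
  moreover have "J \<in> translates_at H y" "J \<notin> translates_at H z"
    using J z by (auto simp: translates_at_def)
  ultimately have "translates_at H z \<subset> translates_at H y"
    by blast
  then have "card (translates_at H z) < card (translates_at H y)"
    using fin[OF y] by (rule psubset_card_mono[rotated])
  then show False
    using y_min[of z] z by simp
qed

text \<open>A half space separating two points of an orbit is a translate of \<open>H\<close> around the first one or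
  the complement of a translate around the second one. If finitely many translates contain \<open>x\<close>,
  this bounds the orbit.\<close>

lemma infinite_translates_at_of_simple:
  assumes disc: "med_discrete M m" and simple: "med_simple G M m \<phi>"
    and nonell: "\<not> elliptic G M m \<phi>" and H: "proper_half_space M m H" and x: "x \<in> M"
  shows "infinite (translates_at H x)"
proof
  assume fin: "finite (translates_at H x)"
  have half: "half_space M m H" and HM: "H \<subseteq> M"
    using H half_space_subset by (auto simp: proper_half_space_def)
  have fin': "finite (translates_at H (\<phi> g x))" "card (translates_at H (\<phi> g x)) = card (translates_at H x)"
    if "g \<in> carrier G" for g
    using bij_betw_translates_at[OF HM that x] fin bij_betw_finite bij_betw_same_card by fastforce+
  have bound: "med_dist M m (\<phi> g x) (\<phi> h x) \<le> 2 * card (translates_at H x)"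
    if g: "g \<in> carrier G" and h: "h \<in> carrier G" for g h
  proof -
    have "separating M m (\<phi> g x) (\<phi> h x) \<subseteq>
        translates_at H (\<phi> g x) \<union> (\<lambda>J. M - J) ` translates_at H (\<phi> h x)"
    proof
      fix J assume J: "J \<in> separating M m (\<phi> g x) (\<phi> h x)"
      then have hs: "half_space M m J" "\<phi> g x \<in> J" "\<phi> h x \<notin> J" "J \<subseteq> M" "\<phi> h x \<in> M"
        using half_space_subset act_closed h x by (auto simp: separating_def)
      then have "proper_half_space M m J"
        by (auto simp: proper_half_space_def)
      then obtain k where "k \<in> carrier G" "J = set_act \<phi> k H \<or> M - J = set_act \<phi> k H"
        using simple H unfolding med_simple_def by blast
      then consider "J \<in> orbit G (set_act \<phi>) H" | "M - J \<in> orbit G (set_act \<phi>) H"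
        by (auto simp: orbit_def)
      then show "J \<in> translates_at H (\<phi> g x) \<union> (\<lambda>J. M - J) ` translates_at H (\<phi> h x)"
      proof cases
        case 1
        then show ?thesis
          using hs by (simp add: translates_at_def)
      next
        case 2
        then have "M - J \<in> translates_at H (\<phi> h x)" "J = M - (M - J)"
          using hs by (auto simp: translates_at_def)
        then show ?thesis
          by blast
      qed
    qed
    then have "med_dist M m (\<phi> g x) (\<phi> h x) \<le>
        card (translates_at H (\<phi> g x) \<union> (\<lambda>J. M - J) ` translates_at H (\<phi> h x))"
      unfolding med_dist_def using fin' g h by (intro card_mono) auto
    also have "\<dots> \<le> card (translates_at H (\<phi> g x)) + card (translates_at H (\<phi> h x))"
      using card_Un_le card_image_le[OF fin'(1)[OF h]] by (meson add_left_mono order_trans)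
    finally show ?thesis
      using fin' g h by simp
  qed
  have "med_bounded M m (orbit G \<phi> x)"
    unfolding med_bounded_def using bound act_closed x by (auto simp: orbit_def)
  then show False
    using nonell x by (auto simp: elliptic_def)
qed

text \<open>If \<open>H\<close> met the orbit in a set of diameter at most \<open>n\<close>, then so would every translate; none of
  the translates around \<open>x\<close> would reach a point of the orbit at distance greater than \<open>n\<close> from
  \<open>x\<close>, so infinitely many half spaces would separate it from \<open>x\<close>.\<close>

lemma unbounded_half_space_orbit:
  assumes disc: "med_discrete M m" and H: "half_space M m H" and x: "x \<in> M"
    and inf: "infinite (translates_at H x)" and unb: "\<not> med_bounded M m (orbit G \<phi> x)"
  shows "\<not> med_bounded M m (H \<inter> orbit G \<phi> x)"
proof
  assume "med_bounded M m (H \<inter> orbit G \<phi> x)"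
  then obtain n where n: "\<And>a b. \<lbrakk>a \<in> H \<inter> orbit G \<phi> x; b \<in> H \<inter> orbit G \<phi> x\<rbrakk> \<Longrightarrow> med_dist M m a b \<le> n"
    by (auto simp: med_bounded_def)
  have "\<exists>g\<in>carrier G. med_dist M m x (\<phi> g x) > n"
  proof (rule ccontr)
    assume near: "\<not> (\<exists>g\<in>carrier G. med_dist M m x (\<phi> g x) > n)"
    have "med_dist M m (\<phi> g x) (\<phi> h x) \<le> n" if "g \<in> carrier G" "h \<in> carrier G" for g h
    proof -
      have "\<phi> h x = \<phi> g (\<phi> (inv\<^bsub>G\<^esub> g \<otimes>\<^bsub>G\<^esub> h) x)"
        using that x by (simp add: composition_rule act_closed act_act_inv)
      then have "med_dist M m (\<phi> g x) (\<phi> h x) = med_dist M m x (\<phi> (inv\<^bsub>G\<^esub> g \<otimes>\<^bsub>G\<^esub> h) x)"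
        using that x act_closed med_dist_act by simp
      then show ?thesis
        using near that by (simp add: not_less)
    qed
    then have "med_bounded M m (orbit G \<phi> x)"
      unfolding med_bounded_def using act_closed x by (auto simp: orbit_def)
    then show False
      using unb by simp
  qed
  then obtain g where g: "g \<in> carrier G" "med_dist M m x (\<phi> g x) > n"
    by blast
  have HM: "H \<subseteq> M"
    using H half_space_subset by blast
  have "translates_at H x \<subseteq> separating M m x (\<phi> g x)"
  proof
    fix J assume J: "J \<in> translates_at H x"
    then obtain h where h: "h \<in> carrier G" "J = set_act \<phi> h H"
      by (auto simp: translates_at_def elim: orbit_set_actE)
    have "\<phi> g x \<notin> J"
    proof
      assume "\<phi> g x \<in> J"
      then have "\<phi> (inv\<^bsub>G\<^esub> h) x \<in> H" "\<phi> (inv\<^bsub>G\<^esub> h) (\<phi> g x) \<in> H"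
        using J h g x HM act_closed by (auto simp: translates_at_def mem_set_act)
      moreover have "\<phi> (inv\<^bsub>G\<^esub> h) (\<phi> g x) = \<phi> (inv\<^bsub>G\<^esub> h \<otimes>\<^bsub>G\<^esub> g) x"
        using h g x by (simp add: composition_rule)
      ultimately have "med_dist M m (\<phi> (inv\<^bsub>G\<^esub> h) x) (\<phi> (inv\<^bsub>G\<^esub> h) (\<phi> g x)) \<le> n"
        using h g by (intro n) (auto simp: orbit_def)
      then show False
        using g h x act_closed med_dist_act by simp
    qed
    then show "J \<in> separating M m x (\<phi> g x)"
      using J orbit_half_space[OF H] by (auto simp: separating_def translates_at_def)
  qed
  then show False
    using inf disc x g act_closed by (meson finite_subset med_discrete_def)
qed

lemma stabilizer_set_act_subgroup:
  assumes "H \<subseteq> M"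
  shows "subgroup (stabilizer G (set_act \<phi>) H) G"
proof (rule G.subgroupI)
  show "stabilizer G (set_act \<phi>) H \<noteq> {}"
    using set_act_one[OF assms] G.one_closed unfolding stabilizer_def by blast
  fix g assume "g \<in> stabilizer G (set_act \<phi>) H"
  then have g: "g \<in> carrier G" "set_act \<phi> g H = H"
    by (auto simp: stabilizer_def)
  show "inv\<^bsub>G\<^esub> g \<in> stabilizer G (set_act \<phi>) H"
    using set_act_inv[OF g(1) assms] g(1) unfolding g(2) by (simp add: stabilizer_def)
  fix h assume "h \<in> stabilizer G (set_act \<phi>) H"
  then have h: "h \<in> carrier G" "set_act \<phi> h H = H"
    by (auto simp: stabilizer_def)
  show "g \<otimes>\<^bsub>G\<^esub> h \<in> stabilizer G (set_act \<phi>) H"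
    using set_act_mult[OF g(1) h(1) assms] g h(1) unfolding h(2) by (simp add: stabilizer_def)
qed (auto simp: stabilizer_def)

end

section \<open>Ends of stabilizers of half spaces\<close>

context median_action
begin

lemma subgroup_pair_stabilizer:
  assumes "H \<subseteq> M"
  shows "subgroup_pair G (stabilizer G (set_act \<phi>) H)"
  by (intro subgroup_pair.intro stabilizer_set_act_subgroup assms) (rule G.is_group)

lemma stabilizer_complement:
  assumes "H \<subseteq> M"
  shows "stabilizer G (set_act \<phi>) (M - H) = stabilizer G (set_act \<phi>) H"
proof -
  have "set_act \<phi> g (M - H) = M - H \<longleftrightarrow> set_act \<phi> g H = H" if "g \<in> carrier G" for g
  proof -
    have "M - A = M - H \<longleftrightarrow> A = H" if "A \<subseteq> M" for A
      using that assms by blast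
    from this[OF set_act_subset[OF that assms]] show ?thesis
      by (simp only: set_act_Diff[OF that assms])
  qed
  then show ?thesis
    unfolding stabilizer_def by blast
qed

lemma left_invariant_visits:
  assumes H: "H \<subseteq> M" and x: "x \<in> M"
  shows "subgroup_pair.left_invariant G (stabilizer G (set_act \<phi>) H) {g \<in> carrier G. \<phi> g x \<in> H}"
proof -
  interpret K: subgroup_pair G "stabilizer G (set_act \<phi>) H"
    by (rule subgroup_pair_stabilizer[OF H])
  show ?thesis
    unfolding K.left_invariant_def
  proof (intro conjI ballI)
    fix k g
    assume "k \<in> stabilizer G (set_act \<phi>) H" and "g \<in> {g \<in> carrier G. \<phi> g x \<in> H}"
    then have k: "k \<in> carrier G" "set_act \<phi> k H = H" and g: "g \<in> carrier G" "\<phi> g x \<in> H"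
      unfolding stabilizer_def by blast+
    have "\<phi> k (\<phi> g x) \<in> set_act \<phi> k H"
      using g(2) by (rule imageI)
    then have "\<phi> (k \<otimes>\<^bsub>G\<^esub> g) x \<in> H"
      unfolding k(2) composition_rule[OF x k(1) g(1)] .
    then show "k \<otimes>\<^bsub>G\<^esub> g \<in> {g \<in> carrier G. \<phi> g x \<in> H}"
      using k(1) g(1) by simp
  qed blast
qed

lemma stabilizer_finite_iff_translates:
  assumes H: "H \<subseteq> M"
    and R: "subgroup_pair.left_invariant G (stabilizer G (set_act \<phi>) H) R"
  shows "R \<in> K_finite_sets G (stabilizer G (set_act \<phi>) H) \<longleftrightarrow>
    finite ((\<lambda>g. set_act \<phi> (inv\<^bsub>G\<^esub> g) H) ` R)"
proof -
  interpret K: subgroup_pair G "stabilizer G (set_act \<phi>) H"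
    by (rule subgroup_pair_stabilizer[OF H])
  define f where "f g = set_act \<phi> (inv\<^bsub>G\<^esub> g) H" for g
  have f_eq: "f g = f h \<longleftrightarrow> g \<otimes>\<^bsub>G\<^esub> inv\<^bsub>G\<^esub> h \<in> stabilizer G (set_act \<phi>) H"
    if g: "g \<in> carrier G" and h: "h \<in> carrier G" for g h
  proof -
    have sub: "f h \<subseteq> M"
      unfolding f_def using set_act_subset[OF G.inv_closed[OF h] H] .
    have "set_act \<phi> (g \<otimes>\<^bsub>G\<^esub> inv\<^bsub>G\<^esub> h) H = set_act \<phi> g (f h)"
      unfolding f_def using set_act_mult[OF g G.inv_closed[OF h] H] .
    moreover have "set_act \<phi> g (f g) = H"
      unfolding f_def using set_act_inv[OF G.inv_closed[OF g] H] g by simp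
    moreover have "f g = f h" if "set_act \<phi> g (f h) = H"
      using set_act_inv[OF g sub] unfolding that by (simp add: f_def)
    moreover have "g \<otimes>\<^bsub>G\<^esub> inv\<^bsub>G\<^esub> h \<in> carrier G"
      using g h by simp
    ultimately show ?thesis
      unfolding stabilizer_def mem_Collect_eq by metis
  qed
  show ?thesis
    using K.K_finite_iff_finite_image[OF R f_eq] by (simp add: f_def)
qed

text \<open>The translate of \<open>H\<close> by the inverse of \<open>g\<close> contains \<open>x\<close> iff \<open>g\<close> moves \<open>x\<close> into \<open>H\<close>, and it
  determines \<open>g\<close> up to the stabilizer.\<close>

lemma stabilizer_finite_visits_iff:
  assumes H: "H \<subseteq> M" and x: "x \<in> M"
  shows "{g \<in> carrier G. \<phi> g x \<in> H} \<in> K_finite_sets G (stabilizer G (set_act \<phi>) H) \<longleftrightarrow>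
    finite (translates_at H x)"
proof -
  have "(\<lambda>g. set_act \<phi> (inv\<^bsub>G\<^esub> g) H) ` {g \<in> carrier G. \<phi> g x \<in> H} = translates_at H x"
  proof (intro equalityI subsetI)
    fix J assume "J \<in> (\<lambda>g. set_act \<phi> (inv\<^bsub>G\<^esub> g) H) ` {g \<in> carrier G. \<phi> g x \<in> H}"
    then obtain g where g: "g \<in> carrier G" "\<phi> g x \<in> H" "J = set_act \<phi> (inv\<^bsub>G\<^esub> g) H"
      by blast
    have "x \<in> J"
      using mem_set_act[OF G.inv_closed[OF g(1)] H x] g by simp
    then show "J \<in> translates_at H x"
      using g G.inv_closed[OF g(1)] unfolding translates_at_def orbit_def by blast
  next
    fix J assume "J \<in> translates_at H x"
    then obtain g where g: "g \<in> carrier G" "J = set_act \<phi> g H" "x \<in> J"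
      by (auto simp: translates_at_def orbit_def)
    show "J \<in> (\<lambda>g. set_act \<phi> (inv\<^bsub>G\<^esub> g) H) ` {g \<in> carrier G. \<phi> g x \<in> H}"
    proof (rule image_eqI)
      show "J = set_act \<phi> (inv\<^bsub>G\<^esub> (inv\<^bsub>G\<^esub> g)) H"
        using g by simp
      show "inv\<^bsub>G\<^esub> g \<in> {g \<in> carrier G. \<phi> g x \<in> H}"
        using mem_set_act[OF g(1) H x] g by simp
    qed
  qed
  then show ?thesis
    using stabilizer_finite_iff_translates[OF H left_invariant_visits[OF H x]] by simp
qed

text \<open>Right translation of the visit set amounts to a change of base point, and an element that
  visits \<open>H\<close> from \<open>y\<close> but not from \<open>z\<close> pulls \<open>H\<close> back to a half space separating \<open>y\<close> from \<open>z\<close>;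
  there are finitely many of those.\<close>

lemma almost_invariant_visits:
  assumes disc: "med_discrete M m" and H: "half_space M m H" and x: "x \<in> M"
  shows "subgroup_pair.almost_invariant G (stabilizer G (set_act \<phi>) H) {g \<in> carrier G. \<phi> g x \<in> H}"
proof -
  have HM: "H \<subseteq> M"
    using H half_space_subset by blast
  interpret K: subgroup_pair G "stabilizer G (set_act \<phi>) H"
    by (rule subgroup_pair_stabilizer[OF HM])
  define S where "S y = {g \<in> carrier G. \<phi> g y \<in> H}" for y
  have S_inv: "K.left_invariant (S y)" if "y \<in> M" for y
    unfolding S_def using left_invariant_visits[OF HM that] .
  have shift: "S x #>\<^bsub>G\<^esub> g = S (\<phi> (inv\<^bsub>G\<^esub> g) x)" if g: "g \<in> carrier G" for g
  proof (intro equalityI subsetI)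
    fix h assume "h \<in> S x #>\<^bsub>G\<^esub> g"
    then obtain k where k: "k \<in> carrier G" "\<phi> k x \<in> H" "h = k \<otimes>\<^bsub>G\<^esub> g"
      by (auto simp: r_coset_def S_def)
    have "\<phi> h (\<phi> (inv\<^bsub>G\<^esub> g) x) = \<phi> k x"
      using k g x act_act_inv[OF g x]
      by (simp add: composition_rule act_closed)
    then show "h \<in> S (\<phi> (inv\<^bsub>G\<^esub> g) x)"
      using k g by (simp add: S_def)
  next
    fix h assume "h \<in> S (\<phi> (inv\<^bsub>G\<^esub> g) x)"
    then have "h \<otimes>\<^bsub>G\<^esub> inv\<^bsub>G\<^esub> g \<in> S x" "h = h \<otimes>\<^bsub>G\<^esub> inv\<^bsub>G\<^esub> g \<otimes>\<^bsub>G\<^esub> g"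
      using g x by (auto simp: S_def composition_rule G.m_assoc)
    then show "h \<in> S x #>\<^bsub>G\<^esub> g"
      by (auto simp: r_coset_def)
  qed
  have diff: "S y - S z \<in> K_finite_sets G (stabilizer G (set_act \<phi>) H)"
    if y: "y \<in> M" and z: "z \<in> M" for y z
  proof -
    have "S y - S z \<subseteq> carrier G"
      by (auto simp: S_def)
    then have inv: "K.left_invariant (S y - S z)"
      using S_inv[OF y] K.left_invariant_mult_iff[OF S_inv[OF z]]
      unfolding K.left_invariant_def by (meson DiffD1 DiffD2 DiffI subsetD)
    have "(\<lambda>g. set_act \<phi> (inv\<^bsub>G\<^esub> g) H) ` (S y - S z) \<subseteq> separating M m y z"
    proof clarify
      fix g assume "g \<in> S y" "g \<notin> S z"
      then have g: "g \<in> carrier G" "\<phi> g y \<in> H" "\<phi> g z \<notin> H"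
        by (auto simp: S_def)
      then show "set_act \<phi> (inv\<^bsub>G\<^esub> g) H \<in> separating M m y z"
        using mem_set_act[OF G.inv_closed[OF g(1)] HM y] mem_set_act[OF G.inv_closed[OF g(1)] HM z]
          half_space_set_act[OF G.inv_closed[OF g(1)] H] by (simp add: separating_def)
    qed
    then have "finite ((\<lambda>g. set_act \<phi> (inv\<^bsub>G\<^esub> g) H) ` (S y - S z))"
      using disc y z finite_subset unfolding med_discrete_def by blast
    then show ?thesis
      using stabilizer_finite_iff_translates[OF HM inv] by blast
  qed
  have "sym_diff (S x) (S x #>\<^bsub>G\<^esub> g) \<in> K_finite_sets G (stabilizer G (set_act \<phi>) H)"
    if g: "g \<in> carrier G" for g
    using diff x g act_closed K.K_finite_Un by (simp add: shift)
  then show ?thesis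
    using S_inv[OF x] unfolding S_def K.almost_invariant_def by blast
qed

lemma ends_stabilizer_gt_one:
  assumes disc: "med_discrete M m" and H: "half_space M m H" and x: "x \<in> M"
    and inf: "infinite (translates_at H x)" "infinite (translates_at (M - H) x)"
  shows "ends G (stabilizer G (set_act \<phi>) H) > 1"
proof -
  have HM: "H \<subseteq> M"
    using H half_space_subset by blast
  interpret K: subgroup_pair G "stabilizer G (set_act \<phi>) H"
    by (rule subgroup_pair_stabilizer[OF HM])
  have "carrier G - {g \<in> carrier G. \<phi> g x \<in> H} = {g \<in> carrier G. \<phi> g x \<in> M - H}"
    using x act_closed by auto
  then have "carrier G - {g \<in> carrier G. \<phi> g x \<in> H} \<notin> K_finite_sets G (stabilizer G (set_act \<phi>) H)"
    using stabilizer_finite_visits_iff[of "M - H" x] x inf(2) stabilizer_complement[OF HM] by simp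
  then show ?thesis
    unfolding K.ends_gt_one_iff
    using almost_invariant_visits[OF disc H x] stabilizer_finite_visits_iff[OF HM x] inf(1) by blast
qed

lemma infinite_orbit_complement:
  assumes "H \<subseteq> M" "infinite (orbit G (set_act \<phi>) H)"
  shows "infinite (orbit G (set_act \<phi>) (M - H))"
proof -
  have "inj_on (\<lambda>J. M - J) (orbit G (set_act \<phi>) H)"
    by (rule inj_onI) (metis assms(1) double_diff orbit_subset subset_refl)
  then show ?thesis
    using assms by (simp add: orbit_complement finite_image_iff)
qed

text \<open>The complement of \<open>H\<close> meets every orbit and has an infinite orbit as well, so both sides have
  infinitely many translates around any point.\<close>

lemma ends_essential_half_space:
  assumes disc: "med_discrete M m" and H: "essential_half_space G M m \<phi> H"
  shows "ends G (stabilizer G (set_act \<phi>) H) > 1"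
proof -
  have half: "half_space M m H" and cuts: "cuts_properly G M m \<phi> H"
    and inf: "infinite (orbit G (set_act \<phi>) H)"
    using H by (auto simp: essential_half_space_def)
  obtain x where x: "x \<in> M"
    using nonempty by blast
  have "med_bounded M m {}"
    by (simp add: med_bounded_def)
  then have meets: "H \<inter> orbit G \<phi> y \<noteq> {}" "(M - H) \<inter> orbit G \<phi> y \<noteq> {}" if "y \<in> M" for y
    using cuts that unfolding cuts_properly_def by metis+
  show ?thesis
  proof (rule ends_stabilizer_gt_one[OF disc half x])
    show "infinite (translates_at H x)"
      using infinite_translates_at_of_meets_orbits[OF disc half inf meets(1) x] .
    show "infinite (translates_at (M - H) x)"
      using infinite_translates_at_of_meets_orbits[OF disc half_space_complement[OF half]
          infinite_orbit_complement[OF half_space_subset[OF half] inf] meets(2) x] .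
  qed
qed

lemma ends_simple_half_space:
  assumes disc: "med_discrete M m" and simple: "med_simple G M m \<phi>"
    and nonell: "\<not> elliptic G M m \<phi>" and H: "proper_half_space M m H"
  shows "ends G (stabilizer G (set_act \<phi>) H) > 1"
proof -
  have half: "half_space M m H"
    using H by (simp add: proper_half_space_def)
  have "proper_half_space M m (M - H)"
    using H half_space_complement half_space_subset by (auto simp: proper_half_space_def)
  then show ?thesis
    using ends_stabilizer_gt_one[OF disc half]
      infinite_translates_at_of_simple[OF disc simple nonell] H nonempty by blast
qed

lemma cuts_properly_of_infinite_translates_at:
  assumes disc: "med_discrete M m" and H: "half_space M m H" and nonell: "\<not> elliptic G M m \<phi>"
    and inf: "\<And>x. x \<in> M \<Longrightarrow> infinite (translates_at H x)"
      "\<And>x. x \<in> M \<Longrightarrow> infinite (translates_at (M - H) x)"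
  shows "cuts_properly G M m \<phi> H"
  unfolding cuts_properly_def
  using unbounded_half_space_orbit[OF disc H] unbounded_half_space_orbit[OF disc half_space_complement[OF H]]
    inf nonell unfolding elliptic_def by blast

end

section \<open>Unbounded displacement in transitive actions\<close>

text \<open>The squared \<open>\<ell>\<^sup>2\<close>-norm of a finitely supported function on \<open>E\<close>. The support is part of the
  summation range because \<open>E\<close> itself may be infinite.\<close>

definition energy :: "'b set \<Rightarrow> ('b \<Rightarrow> real) \<Rightarrow> real" where
  "energy E f = (\<Sum>x | x \<in> E \<and> f x \<noteq> 0. (f x)\<^sup>2)"

lemma energy_eq_sum:
  assumes "finite S" "S \<subseteq> E" "\<And>x. x \<in> E - S \<Longrightarrow> f x = 0"
  shows "energy E f = (\<Sum>x\<in>S. (f x)\<^sup>2)"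
  unfolding energy_def using assms by (intro sum.mono_neutral_left) auto

lemma energy_nonneg: "energy E f \<ge> 0"
  unfolding energy_def by (intro sum_nonneg) simp

lemma energy_ge:
  assumes "finite {x \<in> E. f x \<noteq> 0}" "y \<in> E"
  shows "(f y)\<^sup>2 \<le> energy E f"
proof (cases "f y = 0")
  case True
  then show ?thesis
    by (simp add: energy_nonneg)
next
  case False
  then show ?thesis
    unfolding energy_def using assms by (intro member_le_sum) auto
qed

text \<open>The parallelogram law, solved for the midpoint.\<close>

lemma energy_midpoint:
  assumes u: "finite {x \<in> E. u x \<noteq> 0}" and v: "finite {x \<in> E. v x \<noteq> 0}"
  shows "energy E (\<lambda>x. (u x + v x) / 2) =
    (energy E u + energy E v) / 2 - energy E (\<lambda>x. u x - v x) / 4"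
proof -
  define S where "S = {x \<in> E. u x \<noteq> 0} \<union> {x \<in> E. v x \<noteq> 0}"
  have S: "finite S" "S \<subseteq> E" "\<And>x. x \<in> E - S \<Longrightarrow> u x = 0 \<and> v x = 0"
    using u v by (auto simp: S_def)
  have sums: "energy E u = (\<Sum>x\<in>S. (u x)\<^sup>2)" "energy E v = (\<Sum>x\<in>S. (v x)\<^sup>2)"
    "energy E (\<lambda>x. (u x + v x) / 2) = (\<Sum>x\<in>S. ((u x + v x) / 2)\<^sup>2)"
    "energy E (\<lambda>x. u x - v x) = (\<Sum>x\<in>S. (u x - v x)\<^sup>2)"
    using S(3) by (auto intro!: energy_eq_sum[OF S(1,2)])
  have "(\<Sum>x\<in>S. ((u x + v x) / 2)\<^sup>2) + (\<Sum>x\<in>S. (u x - v x)\<^sup>2) / 4 =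
      (\<Sum>x\<in>S. ((u x + v x) / 2)\<^sup>2 + (u x - v x)\<^sup>2 / 4)"
    by (simp add: sum.distrib sum_divide_distrib)
  also have "\<dots> = (\<Sum>x\<in>S. (u x)\<^sup>2 / 2 + (v x)\<^sup>2 / 2)"
    by (intro sum.cong refl) (simp add: power2_eq_square field_simps)
  also have "\<dots> = ((\<Sum>x\<in>S. (u x)\<^sup>2) + (\<Sum>x\<in>S. (v x)\<^sup>2)) / 2"
    by (simp add: sum.distrib sum_divide_distrib add_divide_distrib)
  finally show ?thesis
    unfolding sums by linarith
qed

lemma energy_bij:
  assumes "bij_betw p E E"
  shows "energy E (\<lambda>x. f (p x)) = energy E f"
proof -
  have "bij_betw p {x \<in> E. f (p x) \<noteq> 0} {x \<in> E. f x \<noteq> 0}"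
    using assms unfolding bij_betw_def by (auto simp: inj_on_def)
  then show ?thesis
    unfolding energy_def by (rule sum.reindex_bij_betw[of p _ _ "\<lambda>x. (f x)\<^sup>2"])
qed

lemma finite_bij_preimage:
  assumes "bij_betw p E E" "finite {x \<in> E. Q x}"
  shows "finite {x \<in> E. Q (p x)}"
proof (rule finite_imageD)
  show "finite (p ` {x \<in> E. Q (p x)})"
    using assms by (auto simp: bij_betw_def intro: finite_subset[OF _ assms(2)])
  show "inj_on p {x \<in> E. Q (p x)}"
    using assms(1) by (auto simp: bij_betw_def inj_on_def)
qed

text \<open>Suppose that all displacements of \<open>T\<close> are at most \<open>n\<close>. Consider the functions that differ
  from the indicator \<open>t\<close> of \<open>T\<close> at finitely many places, and the squared radius of the smallest
  ball around such a function that contains all translates of \<open>t\<close>. For \<open>f\<close> nearly minimising it,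
  the midpoint of \<open>f\<close> and its translate by \<open>h\<close> has, by the parallelogram law, a squared radius
  smaller by a quarter of the energy of their difference. So \<open>f\<close> is nearly invariant. But \<open>f\<close>
  takes the value \<open>1\<close> somewhere on the infinite set \<open>T\<close> and \<open>0\<close> somewhere outside \<open>T\<close>, and some \<open>h\<close>
  moves the first place to the second. Near minimality replaces the circumcentre, which
  need not exist among these functions.\<close>

lemma (in transitive_action) displacement_unbounded:
  assumes T: "T \<subseteq> E" "infinite T" "infinite (E - T)"
    and fin: "\<And>g. g \<in> carrier G \<Longrightarrow> finite (T - \<phi> g ` T)"
  shows "\<exists>g\<in>carrier G. card (T - \<phi> g ` T) > n"
proof (rule ccontr)
  assume "\<not> ?thesis"
  then have card: "card (T - \<phi> g ` T) \<le> n" if "g \<in> carrier G" for g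
    using that by (simp add: not_less)
  interpret group G
    using group_hom group_hom.axioms(1) by blast
  have bij: "bij_betw (\<phi> g) E E" if "g \<in> carrier G" for g
    using bij_prop0[OF that] by (simp add: Bij_def)
  have closed: "\<phi> g x \<in> E" if "g \<in> carrier G" "x \<in> E" for g x
    using element_image that by blast
  have act_inv: "\<phi> g (\<phi> (inv g) x) = x" "\<phi> (inv g) (\<phi> g x) = x" if "g \<in> carrier G" "x \<in> E" for g x
    using orbit_sym_aux[of g x] orbit_sym_aux[of "inv g" x] that by auto
  define t :: "_ \<Rightarrow> real" where "t x = of_bool (x \<in> T)" for x
  have moved: "finite {x \<in> E. t x - t (\<phi> g x) \<noteq> 0}"
    "energy E (\<lambda>x. t x - t (\<phi> g x)) \<le> 2 * real n" if g: "g \<in> carrier G" for g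
  proof -
    have g': "inv g \<in> carrier G"
      using g by simp
    \<comment> \<open>The places where \<open>t\<close> changes lie in the displacements of \<open>T\<close> by \<open>g\<close> and its inverse.\<close>
    define D where "D = (T - \<phi> (inv g) ` T) \<union> \<phi> (inv g) ` (T - \<phi> g ` T)"
    have D: "{x \<in> E. t x - t (\<phi> g x) \<noteq> 0} \<subseteq> D"
    proof
      fix x assume "x \<in> {x \<in> E. t x - t (\<phi> g x) \<noteq> 0}"
      then have x: "x \<in> E" "x \<in> T \<longleftrightarrow> \<phi> g x \<notin> T"
        by (auto simp: t_def split: if_splits)
      show "x \<in> D"
      proof (cases "x \<in> T")
        case True
        have "x \<notin> \<phi> (inv g) ` T"
          using True x T(1) act_inv(1)[OF g] by auto
        then show ?thesis
          using True by (simp add: D_def)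
      next
        case False
        then have "\<phi> g x \<in> T" "x = \<phi> (inv g) (\<phi> g x)"
          using x act_inv(2)[OF g] by auto
        moreover have "\<phi> g x \<notin> \<phi> g ` T"
          using False x T(1) act_inv(2)[OF g] by (metis imageE subsetD)
        ultimately show ?thesis
          by (auto simp: D_def)
      qed
    qed
    have finD: "finite D"
      using fin[OF g] fin[OF g'] by (simp add: D_def)
    have "card D \<le> card (T - \<phi> (inv g) ` T) + card (T - \<phi> g ` T)"
      unfolding D_def using card_Un_le card_image_le[OF fin[OF g]] by (meson add_left_mono order_trans)
    then have cardD: "card D \<le> 2 * n"
      using card[OF g] card[OF g'] by simp
    show "finite {x \<in> E. t x - t (\<phi> g x) \<noteq> 0}"
      using D finD finite_subset by blast
    have "energy E (\<lambda>x. t x - t (\<phi> g x)) \<le> (\<Sum>x | x \<in> E \<and> t x - t (\<phi> g x) \<noteq> 0. 1)"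
      unfolding energy_def by (intro sum_mono) (auto simp: t_def)
    also have "\<dots> \<le> real (card D)"
      using card_mono[OF finD D] by simp
    finally show "energy E (\<lambda>x. t x - t (\<phi> g x)) \<le> 2 * real n"
      using cardD by linarith
  qed
  define near where "near f \<longleftrightarrow> finite {x \<in> E. f x - t x \<noteq> 0}" for f :: "_ \<Rightarrow> real"
  have near_diff: "finite {x \<in> E. f x - t (\<phi> g x) \<noteq> 0}" if "near f" "g \<in> carrier G" for f g
  proof (rule finite_subset)
    show "{x \<in> E. f x - t (\<phi> g x) \<noteq> 0} \<subseteq>
        {x \<in> E. f x - t x \<noteq> 0} \<union> {x \<in> E. t x - t (\<phi> g x) \<noteq> 0}"
      by auto
    show "finite ({x \<in> E. f x - t x \<noteq> 0} \<union> {x \<in> E. t x - t (\<phi> g x) \<noteq> 0})"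
      using that moved(1) by (simp add: near_def)
  qed
  \<comment> \<open>The infimum \<open>Inf B\<close> of all such \<open>b\<close> is the squared circumradius of the orbit of \<open>t\<close>.\<close>
  define reaches where "reaches f b \<longleftrightarrow> near f \<and>
    (\<forall>g\<in>carrier G. energy E (\<lambda>x. f x - t (\<phi> g x)) \<le> b)" for f b
  define B where "B = {b. \<exists>f. reaches f b}"
  have "reaches t (2 * real n)"
    using moved(2) by (simp add: reaches_def near_def)
  then have B_ne: "B \<noteq> {}"
    by (auto simp: B_def)
  have "b \<ge> 0" if "b \<in> B" for b
    using that energy_nonneg one_closed unfolding B_def reaches_def by (blast intro: order_trans)
  then have B_bdd: "bdd_below B"
    by (rule bdd_belowI)
  \<comment> \<open>The slack may be any number below a quarter: the energy found below is at least \<open>1\<close>.\<close>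
  have "Inf B < Inf B + 1 / 8"
    by simp
  then obtain b where "b \<in> B" and b: "b < Inf B + 1 / 8"
    using cInf_lessD[OF B_ne] by blast
  then obtain f where f: "near f" "\<And>g. g \<in> carrier G \<Longrightarrow> energy E (\<lambda>x. f x - t (\<phi> g x)) \<le> b"
    by (auto simp: B_def reaches_def)
  have fin_f: "finite {x \<in> E. f x - t x \<noteq> 0}"
    using f(1) by (simp add: near_def)
  obtain x where x: "x \<in> T" "f x = 1"
  proof -
    have "infinite (T - {x \<in> E. f x - t x \<noteq> 0})"
      using T(2) fin_f by simp
    then obtain x where "x \<in> T - {x \<in> E. f x - t x \<noteq> 0}"
      by (metis ex_in_conv finite.emptyI)
    then show ?thesis
      using T(1) by (intro that[of x]) (auto simp: t_def)
  qed
  obtain y where y: "y \<in> E" "f y = 0"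
  proof -
    have "infinite ((E - T) - {x \<in> E. f x - t x \<noteq> 0})"
      using T(3) fin_f by simp
    then obtain y where "y \<in> (E - T) - {x \<in> E. f x - t x \<noteq> 0}"
      by (metis ex_in_conv finite.emptyI)
    then show ?thesis
      by (intro that[of y]) (auto simp: t_def)
  qed
  obtain h where h: "h \<in> carrier G" "\<phi> h x = y"
    using unique_orbit[of x y] x y T(1) by blast
  define f' where "f' x = f (\<phi> h x)" for x
  have f': "near f'" "\<And>g. g \<in> carrier G \<Longrightarrow> energy E (\<lambda>x. f' x - t (\<phi> g x)) \<le> b"
  proof -
    have "finite {x \<in> E. f (\<phi> h x) - t (\<phi> h x) \<noteq> 0}"
      using finite_bij_preimage[OF bij[OF h(1)] fin_f] .
    then have "finite ({x \<in> E. f (\<phi> h x) - t (\<phi> h x) \<noteq> 0} \<union> {x \<in> E. t x - t (\<phi> h x) \<noteq> 0})"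
      using moved(1)[OF h(1)] by simp
    then show "near f'"
      unfolding near_def by (rule finite_subset[rotated]) (auto simp: f'_def)
    fix g assume g: "g \<in> carrier G"
    have "energy E (\<lambda>x. f' x - t (\<phi> g x)) = energy E (\<lambda>x. f (\<phi> h x) - t (\<phi> (g \<otimes> inv h) (\<phi> h x)))"
    proof -
      have "\<phi> (g \<otimes> inv h) (\<phi> h x) = \<phi> g x" if "x \<in> E" for x
        using that g h(1) closed act_inv(2) by (simp add: composition_rule)
      then show ?thesis
        unfolding energy_def f'_def by (intro sum.cong) auto
    qed
    also have "\<dots> = energy E (\<lambda>x. f x - t (\<phi> (g \<otimes> inv h) x))"
      by (rule energy_bij[OF bij[OF h(1)]])
    also have "\<dots> \<le> b"
      using f(2) g h(1) by simp
    finally show "energy E (\<lambda>x. f' x - t (\<phi> g x)) \<le> b" .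
  qed
  define c where "c = b - energy E (\<lambda>x. f x - f' x) / 4"
  have "reaches (\<lambda>x. (f x + f' x) / 2) c"
    unfolding reaches_def
  proof (intro conjI ballI)
    have "finite ({x \<in> E. f x - t x \<noteq> 0} \<union> {x \<in> E. f' x - t x \<noteq> 0})"
      using f(1) f'(1) by (simp add: near_def)
    then show "near (\<lambda>x. (f x + f' x) / 2)"
      unfolding near_def by (rule finite_subset[rotated]) auto
    fix g assume g: "g \<in> carrier G"
    have "energy E (\<lambda>x. (f x + f' x) / 2 - t (\<phi> g x)) =
        energy E (\<lambda>x. ((f x - t (\<phi> g x)) + (f' x - t (\<phi> g x))) / 2)"
      by (simp add: field_simps)
    also have "\<dots> = (energy E (\<lambda>x. f x - t (\<phi> g x)) + energy E (\<lambda>x. f' x - t (\<phi> g x))) / 2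
        - energy E (\<lambda>x. f x - f' x) / 4"
      by (subst energy_midpoint) (use near_diff f(1) f'(1) g in simp_all)
    also have "\<dots> \<le> c"
      using f(2)[OF g] f'(2)[OF g] by (simp add: c_def)
    finally show "energy E (\<lambda>x. (f x + f' x) / 2 - t (\<phi> g x)) \<le> c" .
  qed
  then have "Inf B \<le> c"
    using B_bdd by (intro cInf_lower) (auto simp: B_def)
  moreover have "energy E (\<lambda>x. f x - f' x) \<ge> 1"
  proof -
    have "finite ({x \<in> E. f x - t x \<noteq> 0} \<union> {x \<in> E. f' x - t x \<noteq> 0})"
      using f(1) f'(1) by (simp add: near_def)
    then have "finite {x \<in> E. f x - f' x \<noteq> 0}"
      by (rule finite_subset[rotated]) auto
    then have "(f x - f' x)\<^sup>2 \<le> energy E (\<lambda>x. f x - f' x)"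
      using x(1) T(1) by (intro energy_ge) auto
    moreover have "f x - f' x = 1"
      by (simp add: f'_def x(2) y(2) h(2))
    ultimately show ?thesis
      by simp
  qed
  ultimately show False
    using b unfolding c_def by linarith
qed

section \<open>The median algebra dual to a wallspace\<close>

text \<open>A wallspace is given by the sides of its walls; a wall is a complementary pair in \<open>P\<close>.\<close>

locale wallspace =
  fixes X :: "'p set" and P :: "'p set set"
  assumes points: "X \<noteq> {}"
    and sides: "B \<in> P \<Longrightarrow> B \<subseteq> X"
    and side_complement: "B \<in> P \<Longrightarrow> X - B \<in> P"
    and side_nonempty: "{} \<notin> P"
    and finite_walls: "\<lbrakk>x \<in> X; y \<in> X\<rbrakk> \<Longrightarrow> finite {B \<in> P. x \<in> B \<and> y \<notin> B}"
begin

definition vertex_at :: "'p \<Rightarrow> 'p set set" where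
  "vertex_at x = {B \<in> P. x \<in> B}"

definition ultra :: "'p set set \<Rightarrow> bool" where
  "ultra U \<longleftrightarrow> U \<subseteq> P \<and> (\<forall>B\<in>P. X - B \<in> U \<longleftrightarrow> B \<notin> U) \<and>
     (\<forall>B\<in>U. \<forall>C\<in>P. B \<subseteq> C \<longrightarrow> C \<in> U)"

text \<open>A vertex chooses one side of every wall consistently with inclusion, and it agrees with the
  choice made by a point of \<open>X\<close> at all but finitely many walls. Counting the sides in \<open>U\<close> only is
  enough, since the complements of \<open>U - V\<close> are the sides in \<open>V - U\<close>.\<close>

definition vertices :: "'p set set set" where
  "vertices = {U. ultra U \<and> (\<exists>x\<in>X. finite (U - vertex_at x))}"

definition majority :: "'p set set \<Rightarrow> 'p set set \<Rightarrow> 'p set set \<Rightarrow> 'p set set" where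
  "majority U V W = (U \<inter> V) \<union> (V \<inter> W) \<union> (U \<inter> W)"

definition halfspace_of :: "'p set \<Rightarrow> 'p set set set" where
  "halfspace_of B = {U \<in> vertices. B \<in> U}"

lemma ultra_vertex_at: "x \<in> X \<Longrightarrow> ultra (vertex_at x)"
  using sides side_complement by (auto simp: ultra_def vertex_at_def)

lemma vertex_at_in_vertices: "x \<in> X \<Longrightarrow> vertex_at x \<in> vertices"
  using ultra_vertex_at by (auto simp: vertices_def intro!: bexI[of _ x])

lemma ultra_subset: "ultra U \<Longrightarrow> U \<subseteq> P"
  by (simp add: ultra_def)

lemma ultra_complement: "\<lbrakk>ultra U; B \<in> P\<rbrakk> \<Longrightarrow> X - B \<in> U \<longleftrightarrow> B \<notin> U"
  by (simp add: ultra_def)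

lemma ultra_up: "\<lbrakk>ultra U; B \<in> U; C \<in> P; B \<subseteq> C\<rbrakk> \<Longrightarrow> C \<in> U"
  by (auto simp: ultra_def)

lemma vertices_ultra: "U \<in> vertices \<Longrightarrow> ultra U"
  by (simp add: vertices_def)

lemma vertices_subset: "U \<in> vertices \<Longrightarrow> U \<subseteq> P"
  using vertices_ultra ultra_subset by blast

lemma ultra_subset_eq:
  assumes "ultra U" "ultra V" "U \<subseteq> V"
  shows "U = V"
proof
  show "V \<subseteq> U"
  proof
    fix B assume B: "B \<in> V"
    then have "B \<in> P" "X - B \<notin> V"
      using assms ultra_subset ultra_complement by blast+
    then show "B \<in> U"
      using assms ultra_complement by blast
  qed
qed fact

lemma ultra_Diff:
  assumes "ultra U" "ultra V"
  shows "V - U = (\<lambda>B. X - B) ` (U - V)"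
proof (intro equalityI subsetI)
  fix B assume B: "B \<in> V - U"
  then have "B \<in> P"
    using assms ultra_subset by blast
  then have "X - B \<in> U - V" "B = X - (X - B)"
    using B assms ultra_complement sides by blast+
  then show "B \<in> (\<lambda>B. X - B) ` (U - V)"
    by blast
next
  fix C assume "C \<in> (\<lambda>B. X - B) ` (U - V)"
  then obtain B where B: "B \<in> U" "B \<notin> V" "C = X - B"
    by blast
  then have "B \<in> P"
    using assms ultra_subset by blast
  then show "C \<in> V - U"
    using B assms ultra_complement by blast
qed

lemma vertices_Diff_finite:
  assumes U: "U \<in> vertices" and V: "V \<in> vertices"
  shows "finite (U - V)"
proof -
  obtain x where x: "x \<in> X" "finite (U - vertex_at x)"
    using U by (auto simp: vertices_def)
  obtain y where y: "y \<in> X" "finite (V - vertex_at y)"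
    using V by (auto simp: vertices_def)
  have "finite (vertex_at y - V)"
    using y ultra_Diff[OF vertices_ultra[OF V] ultra_vertex_at[OF y(1)]] by simp
  moreover have "finite (vertex_at x - vertex_at y)"
    using finite_walls[OF x(1) y(1)] by (rule rev_finite_subset) (auto simp: vertex_at_def)
  moreover have "U - V \<subseteq> (U - vertex_at x) \<union> (vertex_at x - vertex_at y) \<union> (vertex_at y - V)"
    by blast
  ultimately show ?thesis
    using x(2) by (meson finite_UnI finite_subset)
qed

lemma majority_vertex:
  assumes "U \<in> vertices" "V \<in> vertices" "W \<in> vertices"
  shows "majority U V W \<in> vertices"
proof -
  have u: "ultra U" "ultra V" "ultra W"
    using assms vertices_ultra by auto
  have "ultra (majority U V W)"
    unfolding ultra_def
  proof (intro conjI ballI impI)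
    show "majority U V W \<subseteq> P"
      using u ultra_subset by (auto simp: majority_def)
    show "X - B \<in> majority U V W \<longleftrightarrow> B \<notin> majority U V W" if "B \<in> P" for B
      using u[THEN ultra_complement, OF that] by (auto simp: majority_def)
    show "C \<in> majority U V W" if "B \<in> majority U V W" "C \<in> P" "B \<subseteq> C" for B C
      using that u[THEN ultra_up, OF _ that(2,3)] by (auto simp: majority_def)
  qed
  moreover obtain x where x: "x \<in> X"
    using points by blast
  have "finite ((U - vertex_at x) \<union> (V - vertex_at x))"
    using assms vertex_at_in_vertices[OF x] vertices_Diff_finite by simp
  then have "finite (majority U V W - vertex_at x)"
    by (rule rev_finite_subset) (auto simp: majority_def)
  ultimately show ?thesis
    using x by (auto simp: vertices_def)
qed

sublocale dual: median_algebra vertices majority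
proof
  show "vertices \<noteq> {}"
    using points vertex_at_in_vertices by blast
qed (use majority_vertex in \<open>auto simp: majority_def\<close>)

lemma in_interval_iff:
  assumes "U \<in> vertices" "V \<in> vertices"
  shows "W \<in> med_interval vertices majority U V \<longleftrightarrow> W \<in> vertices \<and> U \<inter> V \<subseteq> W \<and> W \<subseteq> U \<union> V"
  unfolding med_interval_def majority_def by auto

lemma halfspace_of_complement:
  assumes "B \<in> P"
  shows "vertices - halfspace_of B = halfspace_of (X - B)"
  using assms vertices_ultra ultra_complement by (auto simp: halfspace_of_def)

lemma half_space_halfspace_of:
  assumes "B \<in> P"
  shows "half_space vertices majority (halfspace_of B)"
proof -
  have "med_convex vertices majority (halfspace_of C)" for C
    unfolding med_convex_def by (auto simp: halfspace_of_def in_interval_iff)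
  then show ?thesis
    unfolding half_space_def halfspace_of_complement[OF assms] by (auto simp: halfspace_of_def)
qed

lemma side_proper: "B \<in> P \<Longrightarrow> B \<noteq> X"
  using side_complement side_nonempty by (metis Diff_cancel)

lemma vertex_at_in_halfspace_of:
  "\<lbrakk>B \<in> P; x \<in> X\<rbrakk> \<Longrightarrow> vertex_at x \<in> halfspace_of B \<longleftrightarrow> x \<in> B"
  using vertex_at_in_vertices by (auto simp: halfspace_of_def vertex_at_def)

lemma inj_on_halfspace_of: "inj_on halfspace_of P"
proof (rule inj_onI)
  fix B C assume BC: "B \<in> P" "C \<in> P" "halfspace_of B = halfspace_of C"
  then have "x \<in> B \<longleftrightarrow> x \<in> C" if "x \<in> X" for x
    using vertex_at_in_halfspace_of that by metis
  then show "B = C"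
    using BC sides by blast
qed

lemma proper_half_space_halfspace_of:
  assumes "B \<in> P"
  shows "proper_half_space vertices majority (halfspace_of B)"
proof -
  obtain x where "x \<in> B"
    using assms side_nonempty by (metis ex_in_conv)
  moreover obtain y where "y \<in> X - B"
    using assms side_proper sides by blast
  ultimately have "vertex_at x \<in> halfspace_of B" "vertex_at y \<in> vertices" "vertex_at y \<notin> halfspace_of B"
    using assms sides vertex_at_in_halfspace_of vertex_at_in_vertices by blast+
  then show ?thesis
    using half_space_halfspace_of[OF assms] by (auto simp: proper_half_space_def)
qed

text \<open>Exchanging a minimal side of a vertex for its complement preserves consistency; this is the
  edge of the dual cube complex that crosses the wall of \<open>B\<close>.\<close>

lemma vertex_flip:
  assumes U: "U \<in> vertices" and B: "B \<in> U"
    and minimal: "\<And>C. \<lbrakk>C \<in> U; C \<subseteq> B\<rbrakk> \<Longrightarrow> C = B"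
  shows "insert (X - B) (U - {B}) \<in> vertices"
proof -
  have u: "ultra U"
    using U vertices_ultra by blast
  have BP: "B \<in> P"
    using u B ultra_subset by blast
  have B_ne: "X - B \<noteq> B"
    using BP side_nonempty sides points by (metis Diff_disjoint Int_absorb Diff_empty)
  have BX: "X - (X - B) = B"
    using sides[OF BP] by (simp add: double_diff)
  have eq_iff: "X - C = B \<longleftrightarrow> C = X - B" if "C \<in> P" for C
    using sides[OF that] sides[OF BP] by blast
  have eq_iff': "X - C = X - B \<longleftrightarrow> C = B" if "C \<in> P" for C
    using sides[OF that] sides[OF BP] by blast
  have "ultra (insert (X - B) (U - {B}))"
    unfolding ultra_def
  proof (intro conjI ballI impI)
    show "insert (X - B) (U - {B}) \<subseteq> P"
      using ultra_subset[OF u] side_complement[OF BP] by blast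
    show "X - C \<in> insert (X - B) (U - {B}) \<longleftrightarrow> C \<notin> insert (X - B) (U - {B})" if "C \<in> P" for C
      using ultra_complement[OF u that] eq_iff[OF that] eq_iff'[OF that] B_ne by auto
    fix C D assume C: "C \<in> insert (X - B) (U - {B})" and D: "D \<in> P" "C \<subseteq> D"
    show "D \<in> insert (X - B) (U - {B})"
    proof (cases "C = X - B")
      case True
      show ?thesis
      proof (cases "D \<in> U")
        case True
        moreover have "D \<noteq> B"
        proof
          assume "D = B"
          then have "B = X"
            using D \<open>C = X - B\<close> sides[OF BP] by blast
          then show False
            using side_proper[OF BP] by simp
        qed
        ultimately show ?thesis
          by simp
      next
        case False
        then have "X - D \<in> U"
          using ultra_complement[OF u D(1)] by simp
        moreover have "X - D \<subseteq> B"
          using D \<open>C = X - B\<close> sides[OF D(1)] by blast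
        ultimately have "X - D = B"
          using minimal by blast
        then show ?thesis
          using eq_iff[OF D(1)] by simp
      qed
    next
      case False
      then have "C \<in> U" "C \<noteq> B"
        using C by auto
      then show ?thesis
        using minimal[of C] ultra_up[OF u _ D] D(2) by blast
    qed
  qed
  moreover obtain x where "x \<in> X" "finite (U - vertex_at x)"
    using U by (auto simp: vertices_def)
  moreover have "insert (X - B) (U - {B}) - vertex_at x \<subseteq> insert (X - B) (U - vertex_at x)" for x
    by blast
  ultimately show ?thesis
    unfolding vertices_def by (metis (mono_tags, lifting) finite_insert finite_subset mem_Collect_eq)
qed

text \<open>Choose \<open>U\<close> inside and \<open>V\<close> outside \<open>H\<close> at minimal distance, and flip a minimal side \<open>B\<close> in
  \<open>U - V\<close>. The flipped vertex \<open>U'\<close> is nearer to \<open>V\<close>, so it lies outside \<open>H\<close>, and the edge from \<open>U\<close> to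
  \<open>U'\<close> leaves \<open>H\<close>. Every other vertex \<open>W\<close> is on the same side as \<open>U\<close> or \<open>U'\<close>, according to whether it
  contains \<open>B\<close>: if it contains \<open>B\<close> then \<open>U\<close> lies between \<open>W\<close> and \<open>U'\<close>, otherwise \<open>U'\<close> lies
  between \<open>W\<close> and \<open>U\<close>.\<close>

lemma proper_half_space_is_side:
  assumes "proper_half_space vertices majority H"
  shows "\<exists>B\<in>P. H = halfspace_of B"
proof -
  have HM: "H \<subseteq> vertices" and hs: "half_space vertices majority H"
    and ne: "H \<noteq> {}" "vertices - H \<noteq> {}"
    using assms by (auto simp: proper_half_space_def half_space_def)
  obtain U0 V0 where "U0 \<in> H" "V0 \<in> vertices - H"
    using ne by blast
  then have "(U0, V0) \<in> H \<times> (vertices - H)"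
    by simp
  from ex_has_least_nat[of "\<lambda>p. p \<in> H \<times> (vertices - H)", OF this, of "\<lambda>p. card (fst p - snd p)"]
  obtain p where p: "p \<in> H \<times> (vertices - H)"
    and p_min: "\<forall>q. q \<in> H \<times> (vertices - H) \<longrightarrow> card (fst p - snd p) \<le> card (fst q - snd q)"
    by (elim exE conjE)
  obtain U V where UV: "p = (U, V)" "U \<in> H" "V \<in> vertices" "V \<notin> H"
    using p by (cases p) auto
  have U: "U \<in> vertices"
    using UV HM by blast
  have uU: "ultra U" and uV: "ultra V"
    using U UV vertices_ultra by auto
  have fin: "finite (U - V)"
    using vertices_Diff_finite U UV by blast
  have "U - V \<noteq> {}"
    using UV ultra_subset_eq[OF uU uV] by blast
  then obtain B where B: "B \<in> U - V" and B_min: "\<And>C. \<lbrakk>C \<in> U - V; C \<subseteq> B\<rbrakk> \<Longrightarrow> C = B"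
    using finite_has_minimal[OF fin] by metis
  have BP: "B \<in> P"
    using B ultra_subset[OF uU] by blast
  define U' where "U' = insert (X - B) (U - {B})"
  have U': "U' \<in> vertices"
    unfolding U'_def
  proof (rule vertex_flip[OF U])
    show "B \<in> U"
      using B by blast
    fix C assume C: "C \<in> U" "C \<subseteq> B"
    have "C \<notin> V"
      using ultra_up[OF uV _ BP C(2)] B by blast
    then show "C = B"
      using B_min C by blast
  qed
  have "X - B \<in> V"
    using B ultra_complement[OF uV BP] by blast
  then have "U' - V = (U - V) - {B}"
    by (auto simp: U'_def)
  then have "card (U' - V) < card (U - V)"
    using B fin by (metis card_Diff1_less)
  then have "U' \<notin> H"
    using p_min[THEN spec, of "(U', V)"] UV U' by auto
  have BU': "B \<notin> U'"
    using vertices_ultra[OF U'] ultra_complement[OF _ BP] by (auto simp: U'_def)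
  have "W \<in> H \<longleftrightarrow> B \<in> W" if W: "W \<in> vertices" for W
  proof
    assume "W \<in> H"
    show "B \<in> W"
    proof (rule ccontr)
      assume "B \<notin> W"
      then have "X - B \<in> W"
        using ultra_complement[OF vertices_ultra[OF W] BP] by blast
      then have "U' \<in> med_interval vertices majority W U"
        using U U' W \<open>B \<notin> W\<close> by (auto simp: in_interval_iff U'_def)
      then show False
        using dual.half_space_interval[OF hs \<open>W \<in> H\<close> UV(2)] \<open>U' \<notin> H\<close> by blast
    qed
  next
    assume "B \<in> W"
    show "W \<in> H"
    proof (rule ccontr)
      assume "W \<notin> H"
      have "X - B \<notin> W"
        using \<open>B \<in> W\<close> ultra_complement[OF vertices_ultra[OF W] BP] by blast
      then have "U \<in> med_interval vertices majority W U'"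
        using U U' W \<open>B \<in> W\<close> B by (auto simp: in_interval_iff U'_def)
      then show False
        using dual.half_space_interval[OF dual.half_space_complement[OF hs], of W U' U]
          \<open>W \<notin> H\<close> \<open>U' \<notin> H\<close> W U' UV(2) by blast
    qed
  qed
  then have "H = halfspace_of B"
    using HM by (auto simp: halfspace_of_def)
  then show ?thesis
    using BP by blast
qed

lemma separating_vertices:
  assumes "U \<in> vertices" "V \<in> vertices"
  shows "separating vertices majority U V = halfspace_of ` (U - V)"
proof (intro equalityI subsetI)
  fix H assume "H \<in> separating vertices majority U V"
  then have H: "half_space vertices majority H" "U \<in> H" "V \<notin> H"
    by (auto simp: separating_def)
  then have "proper_half_space vertices majority H"
    using assms by (auto simp: proper_half_space_def)
  then obtain B where "B \<in> P" "H = halfspace_of B"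
    using proper_half_space_is_side by blast
  then show "H \<in> halfspace_of ` (U - V)"
    using H assms by (auto simp: halfspace_of_def)
next
  fix H assume "H \<in> halfspace_of ` (U - V)"
  then obtain B where B: "B \<in> U" "B \<notin> V" "H = halfspace_of B"
    by blast
  moreover have "B \<in> P"
    using B assms vertices_ultra ultra_subset by blast
  ultimately show "H \<in> separating vertices majority U V"
    using assms half_space_halfspace_of by (auto simp: separating_def halfspace_of_def)
qed

lemma dual_discrete: "med_discrete vertices majority"
  by (simp add: med_discrete_def separating_vertices vertices_Diff_finite)

lemma med_dist_vertices:
  assumes "U \<in> vertices" "V \<in> vertices"
  shows "med_dist vertices majority U V = card (U - V)"
proof -
  have "inj_on halfspace_of (U - V)"
    using assms vertices_ultra ultra_subset by (intro inj_on_subset[OF inj_on_halfspace_of]) blast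
  then show ?thesis
    using assms by (simp add: med_dist_def separating_vertices card_image)
qed

end

section \<open>Wallspaces on a group invariant under left translation\<close>

text \<open>The library's group actions are homomorphisms into a group of extensional bijections; hence
  the restriction.\<close>

lemma group_action_restrictI:
  assumes "group G"
    and closed: "\<And>g x. \<lbrakk>g \<in> carrier G; x \<in> E\<rbrakk> \<Longrightarrow> \<alpha> g x \<in> E"
    and one: "\<And>x. x \<in> E \<Longrightarrow> \<alpha> \<one>\<^bsub>G\<^esub> x = x"
    and mult: "\<And>g h x. \<lbrakk>g \<in> carrier G; h \<in> carrier G; x \<in> E\<rbrakk> \<Longrightarrow> \<alpha> (g \<otimes>\<^bsub>G\<^esub> h) x = \<alpha> g (\<alpha> h x)"
  shows "group_action G E (\<lambda>g. restrict (\<alpha> g) E)"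
proof -
  interpret group G
    by fact
  have inverse: "\<alpha> (inv\<^bsub>G\<^esub> g) (\<alpha> g x) = x" "\<alpha> g (\<alpha> (inv\<^bsub>G\<^esub> g) x) = x" if "g \<in> carrier G" "x \<in> E" for g x
    using mult[of "inv\<^bsub>G\<^esub> g" g x] mult[of g "inv\<^bsub>G\<^esub> g" x] one[OF that(2)] that by simp_all
  have bij: "restrict (\<alpha> g) E \<in> Bij E" if g: "g \<in> carrier G" for g
  proof -
    have "bij_betw (restrict (\<alpha> g) E) E E"
      by (rule bij_betw_byWitness[where f' = "\<alpha> (inv\<^bsub>G\<^esub> g)"]) (use closed g inverse in auto)
    then show ?thesis
      by (simp add: Bij_def)
  qed
  have "restrict (\<alpha> (g \<otimes>\<^bsub>G\<^esub> h)) E = compose E (restrict (\<alpha> g) E) (restrict (\<alpha> h) E)"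
    if "g \<in> carrier G" "h \<in> carrier G" for g h
    using that closed mult by (auto simp: compose_def restrict_def)
  then have "(\<lambda>g. restrict (\<alpha> g) E) \<in> hom G (BijGroup E)"
    using bij by (auto simp: hom_def BijGroup_def)
  then show ?thesis
    by (simp add: group_action_def group_hom_def group_hom_axioms_def group_BijGroup assms(1))
qed

lemma (in group) mem_l_coset_iff:
  assumes "g \<in> carrier G" "B \<subseteq> carrier G" "x \<in> carrier G"
  shows "x \<in> g <# B \<longleftrightarrow> inv g \<otimes> x \<in> B"
proof
  assume "x \<in> g <# B"
  then obtain b where "b \<in> B" "x = g \<otimes> b"
    by (auto simp: l_coset_def)
  moreover have "inv g \<otimes> (g \<otimes> b) = b" if "b \<in> carrier G"
    using assms that by (simp flip: m_assoc)
  ultimately show "inv g \<otimes> x \<in> B"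
    using assms by auto
next
  assume "inv g \<otimes> x \<in> B"
  moreover have "x = g \<otimes> (inv g \<otimes> x)"
    using assms by (simp flip: m_assoc)
  ultimately show "x \<in> g <# B"
    unfolding l_coset_def by blast
qed

lemma (in group) l_coset_Diff:
  assumes "g \<in> carrier G" "B \<subseteq> carrier G"
  shows "g <# (carrier G - B) = carrier G - (g <# B)"
proof -
  have "x \<in> g <# (carrier G - B) \<longleftrightarrow> x \<in> carrier G - (g <# B)" if "x \<in> carrier G" for x
    using assms that by (simp add: mem_l_coset_iff)
  moreover have "g <# (carrier G - B) \<subseteq> carrier G"
    using assms by (intro l_coset_subset_G) auto
  ultimately show ?thesis
    by blast
qed

lemma (in group) l_coset_inv_cancel:
  assumes "g \<in> carrier G" "B \<subseteq> carrier G"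
  shows "inv g <# (g <# B) = B" "g <# (inv g <# B) = B"
  using assms by (simp_all add: lcos_m_assoc lcos_mult_one)

locale invariant_wallspace = group G + wallspace "carrier G" P
  for G :: "('g, 'x) monoid_scheme" (structure) and P +
  assumes translate: "\<lbrakk>g \<in> carrier G; B \<in> P\<rbrakk> \<Longrightarrow> g <# B \<in> P"
begin

definition move :: "'g \<Rightarrow> 'g set set \<Rightarrow> 'g set set" where
  "move g U = (\<lambda>B. g <# B) ` U"

lemma mem_move:
  assumes "g \<in> carrier G" "U \<subseteq> P" "B \<in> P"
  shows "B \<in> move g U \<longleftrightarrow> inv g <# B \<in> U"
proof
  assume "B \<in> move g U"
  then obtain C where C: "C \<in> U" "B = g <# C"
    by (auto simp: move_def)
  then have "C \<subseteq> carrier G"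
    using assms(2) sides by blast
  then show "inv g <# B \<in> U"
    using C assms(1) by (simp add: l_coset_inv_cancel)
next
  assume "inv g <# B \<in> U"
  moreover have "B = g <# (inv g <# B)"
    using l_coset_inv_cancel(2)[OF assms(1) sides[OF assms(3)]] by simp
  ultimately show "B \<in> move g U"
    unfolding move_def by blast
qed

lemma move_subset: "\<lbrakk>g \<in> carrier G; U \<subseteq> P\<rbrakk> \<Longrightarrow> move g U \<subseteq> P"
  using translate by (auto simp: move_def)

lemma move_vertex:
  assumes g: "g \<in> carrier G" and U: "U \<in> vertices"
  shows "move g U \<in> vertices"
proof -
  have u: "ultra U" and UP: "U \<subseteq> P"
    using U vertices_ultra ultra_subset by blast+
  have inv_side: "inv g <# B \<in> P" if "B \<in> P" for B
    using that g translate by simp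
  have "ultra (move g U)"
    unfolding ultra_def
  proof (intro conjI ballI impI)
    show "move g U \<subseteq> P"
      using g UP by (rule move_subset)
    fix B assume B: "B \<in> P"
    have "inv g <# (carrier G - B) = carrier G - (inv g <# B)"
      using g sides[OF B] by (simp add: l_coset_Diff)
    then show "carrier G - B \<in> move g U \<longleftrightarrow> B \<notin> move g U"
      using mem_move[OF g UP B] mem_move[OF g UP side_complement[OF B]]
        ultra_complement[OF u inv_side[OF B]] by simp
  next
    fix B C assume B: "B \<in> move g U" and C: "C \<in> P" "B \<subseteq> C"
    have BP: "B \<in> P"
      using B move_subset[OF g UP] by blast
    have "inv g <# B \<subseteq> inv g <# C"
      using C(2) by (auto simp: l_coset_def)
    then show "C \<in> move g U"
      using B ultra_up[OF u _ inv_side[OF C(1)]] mem_move[OF g UP] BP C(1) by blast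
  qed
  moreover obtain x where x: "x \<in> carrier G" "finite (U - vertex_at x)"
    using U by (auto simp: vertices_def)
  have "move g U - vertex_at (g \<otimes> x) \<subseteq> (\<lambda>B. g <# B) ` (U - vertex_at x)"
  proof
    fix B assume B: "B \<in> move g U - vertex_at (g \<otimes> x)"
    then obtain C where C: "C \<in> U" "B = g <# C"
      by (auto simp: move_def)
    have "C \<notin> vertex_at x"
    proof
      assume "C \<in> vertex_at x"
      then have "g \<otimes> x \<in> B"
        by (auto simp: vertex_at_def C l_coset_def)
      then show False
        using B move_subset[OF g UP] by (auto simp: vertex_at_def)
    qed
    then show "B \<in> (\<lambda>B. g <# B) ` (U - vertex_at x)"
      using C by blast
  qed
  then have "finite (move g U - vertex_at (g \<otimes> x))"
    using x(2) finite_surj by blast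
  ultimately show ?thesis
    using g x(1) unfolding vertices_def by blast
qed

definition act :: "'g \<Rightarrow> 'g set set \<Rightarrow> 'g set set" where
  "act g = restrict (move g) vertices"

lemma act_eq: "U \<in> vertices \<Longrightarrow> act g U = move g U"
  by (simp add: act_def)

lemma median_action_act: "median_action G vertices majority act"
proof -
  have sub: "B \<subseteq> carrier G" if "U \<in> vertices" "B \<in> U" for U B
    using that vertices_ultra ultra_subset sides by blast
  have "group_action G vertices (\<lambda>g. restrict (move g) vertices)"
  proof (rule group_action_restrictI)
    show "group G"
      by (rule is_group)
    show "move g U \<in> vertices" if "g \<in> carrier G" "U \<in> vertices" for g U
      using that by (rule move_vertex)
    show "move \<one> U = U" if "U \<in> vertices" for U
    proof -
      have "move \<one> U = (\<lambda>B. B) ` U"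
        unfolding move_def using sub[OF that] lcos_mult_one by (intro image_cong) auto
      then show ?thesis
        by simp
    qed
    show "move (g \<otimes> h) U = move g (move h U)" if "g \<in> carrier G" "h \<in> carrier G" "U \<in> vertices" for g h U
      unfolding move_def image_image using that sub[OF that(3)] lcos_m_assoc by (intro image_cong) auto
  qed
  then have "group_action G vertices act"
    by (simp add: act_def[abs_def])
  moreover have "act g (majority U V W) = majority (act g U) (act g V) (act g W)"
    if g: "g \<in> carrier G" and UVW: "U \<in> vertices" "V \<in> vertices" "W \<in> vertices" for g U V W
  proof -
    have inj: "inj_on (\<lambda>B. g <# B) P"
      by (rule inj_onI) (metis g l_coset_inv_cancel(1) sides)
    have "move g (C \<inter> D) = move g C \<inter> move g D" if "C \<in> vertices" "D \<in> vertices" for C D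
      unfolding move_def using inj_on_image_Int[OF inj] that vertices_subset by simp
    moreover have "move g (C \<union> D) = move g C \<union> move g D" for C D
      by (simp add: move_def image_Un)
    ultimately have "move g (majority U V W) = majority (move g U) (move g V) (move g W)"
      using UVW by (simp only: majority_def)
    then show ?thesis
      using UVW majority_vertex by (simp add: act_eq)
  qed
  ultimately show ?thesis
    by (simp add: median_action_def median_action_axioms_def dual.median_algebra_axioms)
qed

lemma set_act_halfspace_of:
  assumes g: "g \<in> carrier G" and B: "B \<in> P"
  shows "set_act act g (halfspace_of B) = halfspace_of (g <# B)"
proof -
  interpret median_action G vertices majority act
    by (rule median_action_act)
  have gB: "g <# B \<in> P"
    using g B by (rule translate)
  have "U \<in> set_act act g (halfspace_of B) \<longleftrightarrow> U \<in> halfspace_of (g <# B)" if U: "U \<in> vertices" for U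
  proof -
    have UP: "U \<subseteq> P"
      using U vertices_ultra ultra_subset by blast
    have "halfspace_of B \<subseteq> vertices"
      by (auto simp: halfspace_of_def)
    then have "U \<in> set_act act g (halfspace_of B) \<longleftrightarrow> act (inv g) U \<in> halfspace_of B"
      using mem_set_act g U by blast
    also have "\<dots> \<longleftrightarrow> g <# B \<in> U"
      using g U B UP mem_move[of "inv g" U B] move_vertex[of "inv g" U] by (simp add: halfspace_of_def act_eq)
    finally show ?thesis
      using U by (simp add: halfspace_of_def)
  qed
  moreover have "set_act act g (halfspace_of B) \<subseteq> vertices" "halfspace_of (g <# B) \<subseteq> vertices"
    using act_closed[OF g] by (auto simp: halfspace_of_def)
  ultimately show ?thesis
    by blast
qed

end

section \<open>The action dual to an almost invariant set\<close>

context subgroup_pair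
begin

text \<open>The walls are given by the left translates of \<open>A\<close>. Three counting facts carry the proof.
  Two elements of \<open>G\<close> are separated by finitely many translates, because \<open>A\<close> is almost invariant.
  The group \<open>L\<close> of all \<open>g\<close> with \<open>g A = A\<close> has finitely many cosets of \<open>K\<close>, because its elements
  move a fixed pair of elements separated by \<open>A\<close> to pairs separated by \<open>A\<close>. Since \<open>A\<close> and its complement are not
  \<open>K\<close>-finite, at each vertex infinitely many translates are chosen and infinitely many
  are not. The last fact makes orbits unbounded, by applying \<open>displacement_unbounded\<close> to the
  transitive action on the translates, and makes the half space of \<open>A\<close> essential.\<close>

theorem dual_action_exists:
  assumes A: "almost_invariant A" and nontrivial: "A \<notin> K_finite_sets G K" "carrier G - A \<notin> K_finite_sets G K"
  shows "\<exists>(M :: 'g set set set) m \<phi> H. median_action G M m \<phi> \<and> med_discrete M m \<and>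
    med_simple G M m \<phi> \<and> \<not> elliptic G M m \<phi> \<and> proper_half_space M m H \<and>
    essential_half_space G M m \<phi> H \<and> finite_index_in G K (stabilizer G (set_act \<phi>) H)"
proof -
  have A_inv: "left_invariant A" and AG: "A \<subseteq> carrier G"
    using A by (simp_all add: almost_invariant_def left_invariant_def)
  have A_ne: "A \<noteq> {}" "carrier G - A \<noteq> {}"
    using nontrivial K_finite_empty by metis+
  have fix_K: "inv k <# A = A" "k <# A = A" if "k \<in> K" for k
  proof -
    have "l <# A = A" if l: "l \<in> K" for l
    proof -
      have "x \<in> l <# A \<longleftrightarrow> x \<in> A" if "x \<in> carrier G" for x
        using left_invariant_mult_iff[OF A_inv, of "inv l" x] l that AG
        by (simp add: mem_l_coset_iff)
      moreover have "l <# A \<subseteq> carrier G"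
        using l AG by (simp add: l_coset_subset_G)
      ultimately show ?thesis
        using AG by blast
    qed
    then show "inv k <# A = A" "k <# A = A"
      using that by simp_all
  qed
  define T where "T = (\<lambda>g. g <# A) ` carrier G"
  define P where "P = T \<union> (\<lambda>B. carrier G - B) ` T"
  have T_sub: "B \<subseteq> carrier G" if "B \<in> T" for B
    using that AG l_coset_subset_G by (auto simp: T_def)
  have walls_T: "finite {B \<in> T. x \<in> B \<and> y \<notin> B}" if x: "x \<in> carrier G" and y: "y \<in> carrier G" for x y
  proof -
    obtain F where F: "F \<subseteq> carrier G" "finite F"
      "\<And>h. \<lbrakk>h \<in> A; h \<otimes> (inv x \<otimes> y) \<notin> A\<rbrakk> \<Longrightarrow> \<exists>k\<in>K. \<exists>f\<in>F. h = k \<otimes> f"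
      using crossing_representatives[OF A, of "inv x \<otimes> y"] x y by (metis inv_closed m_closed)
    have "{B \<in> T. x \<in> B \<and> y \<notin> B} \<subseteq> (\<lambda>f. (x \<otimes> inv f) <# A) ` F"
    proof
      fix B assume "B \<in> {B \<in> T. x \<in> B \<and> y \<notin> B}"
      then obtain g where g: "g \<in> carrier G" "B = g <# A" "x \<in> g <# A" "y \<notin> g <# A"
        by (auto simp: T_def)
      have "inv g \<otimes> x \<otimes> (inv x \<otimes> y) = inv g \<otimes> y"
        using g(1) x y by (metis inv_closed inv_solve_left m_assoc m_closed)
      then obtain k f where kf: "k \<in> K" "f \<in> F" "inv g \<otimes> x = k \<otimes> f"
        using F(3)[of "inv g \<otimes> x"] g x y AG by (auto simp: mem_l_coset_iff)
      have fG: "f \<in> carrier G" and kG: "k \<in> carrier G"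
        using kf F(1) by auto
      have "g = x \<otimes> inv (inv g \<otimes> x)"
        using g(1) x by (simp add: inv_mult_group flip: m_assoc)
      also have "\<dots> = (x \<otimes> inv f) \<otimes> inv k"
        using x fG kG by (simp add: kf(3) inv_mult_group m_assoc)
      finally have "B = ((x \<otimes> inv f) \<otimes> inv k) <# A"
        using g(2) by simp
      also have "\<dots> = (x \<otimes> inv f) <# (inv k <# A)"
        using x fG kG AG by (simp add: lcos_m_assoc)
      finally show "B \<in> (\<lambda>f. (x \<otimes> inv f) <# A) ` F"
        using fix_K(1)[OF kf(1)] kf(2) by simp
    qed
    then show ?thesis
      using F(2) finite_surj by blast
  qed
  have T_translate: "g <# B \<in> T" if "g \<in> carrier G" "B \<in> T" for g B
    using that AG by (auto simp: T_def lcos_m_assoc)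
  have T_proper: "B \<noteq> {} \<and> carrier G - B \<noteq> {}" if B: "B \<in> T" for B
  proof -
    obtain g where g: "g \<in> carrier G" "B = g <# A"
      using B by (auto simp: T_def)
    then have "carrier G - B = g <# (carrier G - A)"
      using AG by (simp add: l_coset_Diff)
    then show ?thesis
      using A_ne g by (auto simp: l_coset_def)
  qed
  interpret W: invariant_wallspace G P
  proof
    show "carrier G \<noteq> {}"
      using one_closed by blast
    show "B \<subseteq> carrier G" if "B \<in> P" for B
      using that T_sub by (auto simp: P_def)
    show "carrier G - B \<in> P" if "B \<in> P" for B
      using that T_sub by (auto simp: P_def double_diff)
    show "{} \<notin> P"
      using T_proper by (auto simp: P_def)
    show "finite {B \<in> P. x \<in> B \<and> y \<notin> B}" if "x \<in> carrier G" "y \<in> carrier G" for x y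
    proof (rule finite_subset)
      show "{B \<in> P. x \<in> B \<and> y \<notin> B} \<subseteq>
          {B \<in> T. x \<in> B \<and> y \<notin> B} \<union> (\<lambda>B. carrier G - B) ` {B \<in> T. y \<in> B \<and> x \<notin> B}"
        using that by (auto simp: P_def)
      show "finite ({B \<in> T. x \<in> B \<and> y \<notin> B} \<union> (\<lambda>B. carrier G - B) ` {B \<in> T. y \<in> B \<and> x \<notin> B})"
        using walls_T that by simp
    qed
    show "g <# B \<in> P" if "g \<in> carrier G" "B \<in> P" for g B
      using that T_translate T_sub by (auto simp: P_def l_coset_Diff)
  qed
  interpret D: median_action G W.vertices W.majority W.act
    by (rule W.median_action_act)
  have TP: "T \<subseteq> P"
    by (simp add: P_def)
  have AT: "A \<in> T"
    using AG lcos_mult_one by (auto simp: T_def image_iff intro!: bexI[of _ \<one>])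
  define L where "L = {g \<in> carrier G. g <# A = A}"
  \<comment> \<open>Fix \<open>a\<close> in \<open>A\<close> and \<open>b\<close> outside. For \<open>l\<close> in \<open>L\<close>, right multiplication takes \<open>l a\<close> in \<open>A\<close> to
    \<open>l b\<close> outside.\<close>
  obtain F where F: "F \<subseteq> carrier G" "finite F" "L \<subseteq> K <#> F"
  proof -
    obtain a where a: "a \<in> A" "a \<in> carrier G"
      using A_ne AG by blast
    obtain b where b: "b \<in> carrier G" "b \<notin> A"
      using A_ne by blast
    obtain E where E: "E \<subseteq> carrier G" "finite E"
      "\<And>h. \<lbrakk>h \<in> A; h \<otimes> (inv a \<otimes> b) \<notin> A\<rbrakk> \<Longrightarrow> \<exists>k\<in>K. \<exists>f\<in>E. h = k \<otimes> f"
      using crossing_representatives[OF A, of "inv a \<otimes> b"] a b by (metis inv_closed m_closed)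
    have "L \<subseteq> K <#> (E #> inv a)"
    proof
      fix l assume "l \<in> L"
      then have l: "l \<in> carrier G" "l <# A = A"
        by (auto simp: L_def)
      have "l \<otimes> a \<in> A"
        using a l by (auto simp: l_coset_def)
      moreover have "l \<otimes> b \<notin> A"
        using mem_l_coset_iff[OF l(1) AG, of "l \<otimes> b"] l b by (simp flip: m_assoc)
      moreover have "l \<otimes> a \<otimes> (inv a \<otimes> b) = l \<otimes> b"
        using l(1) a b by (metis inv_closed inv_solve_left m_assoc m_closed)
      ultimately obtain k f where kf: "k \<in> K" "f \<in> E" "l \<otimes> a = k \<otimes> f"
        using E(3)[of "l \<otimes> a"] by auto
      have "l = l \<otimes> a \<otimes> inv a"
        using l(1) a by (simp add: m_assoc)
      also have "\<dots> = k \<otimes> (f \<otimes> inv a)"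
        using kf E(1) a by (simp add: m_assoc subset_iff)
      finally show "l \<in> K <#> (E #> inv a)"
        using kf by (auto simp: set_mult_def r_coset_def)
    qed
    moreover have "E #> inv a \<subseteq> carrier G" "finite (E #> inv a)"
      using E a by (auto simp: r_coset_def)
    ultimately show thesis
      using that by blast
  qed
  \<comment> \<open>The translate of \<open>A\<close> by the inverse of \<open>g\<close> determines \<open>g\<close> up to \<open>L\<close>, hence up to \<open>K\<close> and finitely
    many choices.\<close>
  have infinite_translates: "infinite ((\<lambda>g. inv g <# A) ` R)"
    if R: "left_invariant R" "R \<notin> K_finite_sets G K" for R
  proof
    assume "finite ((\<lambda>g. inv g <# A) ` R)"
    then obtain S where S: "S \<subseteq> R" "finite S" "(\<lambda>g. inv g <# A) ` R = (\<lambda>g. inv g <# A) ` S"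
      by (meson finite_subset_image subset_refl)
    have RG: "R \<subseteq> carrier G"
      using R by (simp add: left_invariant_def)
    have "R \<subseteq> K <#> (F <#> S)"
    proof
      fix r assume r: "r \<in> R"
      then obtain s where s: "s \<in> S" "inv r <# A = inv s <# A"
        using S(3) by (metis (mono_tags, lifting) imageE imageI)
      have rs: "r \<in> carrier G" "s \<in> carrier G"
        using r s S(1) RG by auto
      have "(r \<otimes> inv s) <# A = r <# (inv s <# A)"
        using rs AG by (simp add: lcos_m_assoc)
      also have "\<dots> = A"
        using rs AG s(2) l_coset_inv_cancel(2)[of r A] by simp
      finally have "r \<otimes> inv s \<in> K <#> F"
        using rs F(3) by (auto simp: L_def)
      then obtain k f where kf: "k \<in> K" "f \<in> F" "r \<otimes> inv s = k \<otimes> f"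
        by (auto simp: set_mult_def)
      have "r = r \<otimes> inv s \<otimes> s"
        using rs by (simp add: m_assoc)
      also have "\<dots> = k \<otimes> (f \<otimes> s)"
        using kf F(1) rs by (simp add: m_assoc subset_iff)
      finally show "r \<in> K <#> (F <#> S)"
        using kf s(1) by (auto simp: set_mult_def)
    qed
    moreover have "F <#> S \<subseteq> carrier G"
      using F(1) S(1) RG by (intro set_mult_closed) auto
    moreover have "finite (F <#> S)"
      using F(2) S(2) by (simp add: set_mult_def)
    ultimately show False
      using K_finite_subset[of "K <#> (F <#> S)" R] R unfolding K_finite_sets_def by blast
  qed
  have T_at_one: "infinite {B \<in> T. \<one> \<in> B}" "infinite {B \<in> T. \<one> \<notin> B}"
  proof -
    have mem: "\<one> \<in> inv g <# A \<longleftrightarrow> g \<in> A" if "g \<in> carrier G" for g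
      using that AG by (simp add: mem_l_coset_iff)
    have inT: "inv g <# A \<in> T" if "g \<in> carrier G" for g
      using that by (simp add: T_def)
    have "(\<lambda>g. inv g <# A) ` A \<subseteq> {B \<in> T. \<one> \<in> B}"
      using mem inT AG by auto
    then show "infinite {B \<in> T. \<one> \<in> B}"
      using infinite_translates[OF A_inv nontrivial(1)] finite_subset by blast
    have "(\<lambda>g. inv g <# A) ` (carrier G - A) \<subseteq> {B \<in> T. \<one> \<notin> B}"
      using mem inT by auto
    then show "infinite {B \<in> T. \<one> \<notin> B}"
      using infinite_translates[OF left_invariant_complement[OF A_inv] nontrivial(2)] finite_subset by blast
  qed
  \<comment> \<open>The vertex of the unit element has this property, and any other vertex differs from it in
    finitely many sides.\<close>
  have T_at: "infinite (T \<inter> U)" "infinite (T - U)" if U: "U \<in> W.vertices" for U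
  proof -
    have one: "W.vertex_at \<one> \<in> W.vertices"
      by (simp add: W.vertex_at_in_vertices)
    have "{B \<in> T. \<one> \<in> B} \<subseteq> (T \<inter> U) \<union> (W.vertex_at \<one> - U)"
      using TP by (auto simp: W.vertex_at_def)
    then show "infinite (T \<inter> U)"
      using T_at_one(1) W.vertices_Diff_finite[OF one U] by (meson finite_UnI finite_subset)
    have "{B \<in> T. \<one> \<notin> B} \<subseteq> (T - U) \<union> (U - W.vertex_at \<one>)"
      by (auto simp: W.vertex_at_def)
    then show "infinite (T - U)"
      using T_at_one(2) W.vertices_Diff_finite[OF U one] by (meson finite_UnI finite_subset)
  qed
  \<comment> \<open>The distance from \<open>U\<close> to its image under \<open>g\<close> is at least the displacement of the set of
    translates chosen by \<open>U\<close>.\<close>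
  define \<tau> where "\<tau> g = restrict (\<lambda>B. g <# B) T" for g
  have "group_action G T \<tau>"
    unfolding \<tau>_def[abs_def] using T_translate T_sub
    by (intro group_action_restrictI is_group) (simp_all add: lcos_mult_one lcos_m_assoc)
  moreover have "\<exists>g\<in>carrier G. \<tau> g B = C" if "B \<in> T" "C \<in> T" for B C
  proof -
    obtain b c where bc: "b \<in> carrier G" "B = b <# A" "c \<in> carrier G" "C = c <# A"
      using \<open>B \<in> T\<close> \<open>C \<in> T\<close> by (auto simp: T_def)
    have "(c \<otimes> inv b) <# B = C"
      using bc AG by (simp add: lcos_m_assoc m_assoc)
    then show ?thesis
      using bc that by (intro bexI[of _ "c \<otimes> inv b"]) (simp_all add: \<tau>_def)
  qed
  ultimately interpret \<tau>: transitive_action G T \<tau>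
    by (simp add: transitive_action_def transitive_action_axioms_def)
  have unbounded: "\<exists>g\<in>carrier G. med_dist W.vertices W.majority U (W.act g U) > n"
    if U: "U \<in> W.vertices" for U n
  proof -
    have moved: "T \<inter> U - \<tau> g ` (T \<inter> U) \<subseteq> U - W.act g U" if g: "g \<in> carrier G" for g
    proof
      fix B assume B: "B \<in> T \<inter> U - \<tau> g ` (T \<inter> U)"
      have "B \<notin> W.move g U"
      proof
        assume "B \<in> W.move g U"
        then obtain C where C: "C \<in> U" "B = g <# C"
          by (auto simp: W.move_def)
        then have "C \<subseteq> carrier G"
          using U W.vertices_ultra W.ultra_subset W.sides by blast
        then have "C = inv g <# B"
          using C g by (simp add: l_coset_inv_cancel)
        then have "C \<in> T"
          using B g T_translate by simp
        then have "B = \<tau> g C"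
          using C by (simp add: \<tau>_def)
        then show False
          using B C \<open>C \<in> T\<close> by blast
      qed
      then show "B \<in> U - W.act g U"
        using B U by (simp add: W.act_eq)
    qed
    have fin: "finite (U - W.act g U)" if "g \<in> carrier G" for g
      using W.vertices_Diff_finite[OF U D.act_closed[OF that U]] .
    have "T - T \<inter> U = T - U"
      by blast
    then obtain g where g: "g \<in> carrier G" "card (T \<inter> U - \<tau> g ` (T \<inter> U)) > n"
      using \<tau>.displacement_unbounded[of "T \<inter> U" n] T_at[OF U] finite_subset[OF moved fin] by auto
    then have "card (U - W.act g U) > n"
      using card_mono[OF fin moved] by (meson less_le_trans)
    then show ?thesis
      using g(1) W.med_dist_vertices[OF U D.act_closed[OF g(1) U]] by metis
  qed
  have nonell: "\<not> elliptic G W.vertices W.majority W.act"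
  proof
    assume "elliptic G W.vertices W.majority W.act"
    then obtain U n where U: "U \<in> W.vertices"
      and n: "\<And>V V'. \<lbrakk>V \<in> orbit G W.act U; V' \<in> orbit G W.act U\<rbrakk> \<Longrightarrow> med_dist W.vertices W.majority V V' \<le> n"
      unfolding elliptic_def med_bounded_def by blast
    obtain g where g: "g \<in> carrier G" "med_dist W.vertices W.majority U (W.act g U) > n"
      using unbounded[OF U] by blast
    moreover have "U \<in> orbit G W.act U" "W.act g U \<in> orbit G W.act U"
      using D.orbit_refl[OF U] g(1) by (auto simp: orbit_def)
    ultimately show False
      using n by (meson not_less)
  qed
  define H where "H = W.halfspace_of A"
  have AP: "A \<in> P"
    using AT TP by blast
  have H: "proper_half_space W.vertices W.majority H"
    unfolding H_def using W.proper_half_space_halfspace_of[OF AP] .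
  have half: "half_space W.vertices W.majority H"
    unfolding H_def using W.half_space_halfspace_of[OF AP] .
  have orbit_H: "orbit G (set_act W.act) H = W.halfspace_of ` T"
  proof -
    have "orbit G (set_act W.act) H = (\<lambda>g. set_act W.act g H) ` carrier G"
      unfolding orbit_def by blast
    also have "\<dots> = (\<lambda>g. W.halfspace_of (g <# A)) ` carrier G"
      unfolding H_def by (intro image_cong refl W.set_act_halfspace_of AP)
    finally show ?thesis
      by (simp add: T_def image_image)
  qed
  have at_H: "infinite (D.translates_at H U)" if U: "U \<in> W.vertices" for U
  proof -
    have "D.translates_at H U = W.halfspace_of ` (T \<inter> U)"
      unfolding D.translates_at_def orbit_H using U by (auto simp: W.halfspace_of_def)
    moreover have "inj_on W.halfspace_of (T \<inter> U)"
      using TP by (intro inj_on_subset[OF W.inj_on_halfspace_of]) blast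
    ultimately show ?thesis
      using T_at(1)[OF U] finite_imageD by metis
  qed
  have at_H': "infinite (D.translates_at (W.vertices - H) U)" if U: "U \<in> W.vertices" for U
  proof -
    have "(\<lambda>J. W.vertices - J) ` W.halfspace_of ` (T - U) \<subseteq> D.translates_at (W.vertices - H) U"
      unfolding D.translates_at_def D.orbit_complement[OF W.dual.half_space_subset[OF half]] orbit_H
      using U by (auto simp: W.halfspace_of_def)
    moreover have "inj_on (\<lambda>J. W.vertices - J) (W.halfspace_of ` (T - U))"
      by (rule inj_onI) (auto simp: W.halfspace_of_def)
    moreover have "inj_on W.halfspace_of (T - U)"
      using TP by (intro inj_on_subset[OF W.inj_on_halfspace_of]) blast
    ultimately show ?thesis
      using T_at(2)[OF U] by (meson finite_imageD finite_subset)
  qed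
  have cuts: "cuts_properly G W.vertices W.majority W.act H"
    using D.cuts_properly_of_infinite_translates_at[OF W.dual_discrete half nonell at_H at_H'] .
  have "infinite (orbit G (set_act W.act) H)"
  proof -
    obtain U where "U \<in> W.vertices"
      using W.dual.nonempty by blast
    moreover have "D.translates_at H U \<subseteq> orbit G (set_act W.act) H"
      by (auto simp: D.translates_at_def)
    ultimately show ?thesis
      using at_H finite_subset by blast
  qed
  then have essential: "essential_half_space G W.vertices W.majority W.act H"
    using half cuts by (simp add: essential_half_space_def)
  have simple: "med_simple G W.vertices W.majority W.act"
    unfolding med_simple_def
  proof (intro allI impI)
    fix I J
    assume "proper_half_space W.vertices W.majority I \<and> proper_half_space W.vertices W.majority J"
    then obtain B C where BC: "B \<in> P" "I = W.halfspace_of B" "C \<in> P" "J = W.halfspace_of C"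
      using W.proper_half_space_is_side by metis
    have "\<exists>g\<in>carrier G. B = g <# A \<or> B = carrier G - (g <# A)" if "B \<in> P" for B
      using that by (auto simp: P_def T_def)
    then obtain b c where b: "b \<in> carrier G" "B = b <# A \<or> B = carrier G - (b <# A)"
      and c: "c \<in> carrier G" "C = c <# A \<or> C = carrier G - (c <# A)"
      using BC by metis
    define g where "g = c \<otimes> inv b"
    have g: "g \<in> carrier G"
      using b c by (simp add: g_def)
    have gb: "g <# (b <# A) = c <# A"
      using b c AG by (simp add: g_def lcos_m_assoc m_assoc)
    have sub: "b <# A \<subseteq> carrier G" "c <# A \<subseteq> carrier G"
      using b c AG l_coset_subset_G by auto
    have "C = g <# B \<or> carrier G - C = g <# B"
      using b(2) c(2) gb l_coset_Diff[OF g sub(1)] sub(2) by (auto simp: double_diff)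
    then have "J = W.halfspace_of (g <# B) \<or> W.vertices - J = W.halfspace_of (g <# B)"
      using BC W.halfspace_of_complement by auto
    then show "\<exists>g\<in>carrier G. J = set_act W.act g I \<or> W.vertices - J = set_act W.act g I"
      using g W.set_act_halfspace_of[OF g BC(1)] BC(2) by metis
  qed
  have stab: "stabilizer G (set_act W.act) H = L"
  proof -
    have "set_act W.act g H = H \<longleftrightarrow> g <# A = A" if g: "g \<in> carrier G" for g
      unfolding H_def W.set_act_halfspace_of[OF g AP]
      using W.inj_on_halfspace_of AP W.translate[OF g AP] by (simp add: inj_on_eq_iff)
    then show ?thesis
      unfolding stabilizer_def L_def by blast
  qed
  have "finite_index_in G K L"
    unfolding finite_index_in_def
  proof
    have "subgroup L G"
      using D.stabilizer_set_act_subgroup[OF W.dual.half_space_subset[OF half]] by (simp only: stab)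
    moreover have "K \<subseteq> L"
      using fix_K(2) by (auto simp: L_def)
    ultimately show "subgroup K (G\<lparr>carrier := L\<rparr>)"
      using subgroup_incl K.subgroup_axioms by blast
    have "K #> l \<in> (#>) K ` F" if l: "l \<in> L" for l
    proof -
      obtain k f where kf: "k \<in> K" "f \<in> F" "l = k \<otimes> f"
        using l F(3) by (auto simp: set_mult_def)
      then have "l \<otimes> inv f \<in> K"
        using F(1) by (auto simp: m_assoc)
      then have "K #> l = K #> f"
        using l kf F(1) by (subst r_coset_eq_iff) (auto simp: L_def)
      then show ?thesis
        using kf(2) by blast
    qed
    then have "rcosets\<^bsub>G\<lparr>carrier := L\<rparr>\<^esub> K \<subseteq> (#>) K ` F"
      by (auto simp: RCOSETS_def)
    then show "finite (rcosets\<^bsub>G\<lparr>carrier := L\<rparr>\<^esub> K)"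
      using F(2) finite_surj by blast
  qed
  then show ?thesis
    using median_action.intro W.median_action_act W.dual_discrete simple nonell H essential
    unfolding stab[symmetric] by blast
qed

end

section \<open>Characterisation by actions\<close>

text \<open>Two points of an unbounded orbit have positive distance, and a half space separating them is
  proper.\<close>

lemma nonelliptic_simple_action_half_space:
  assumes "nonelliptic_simple_action G M m \<phi>"
  shows "\<exists>H. proper_half_space M m H"
proof -
  interpret median_action G M m \<phi>
    using assms by (simp add: nonelliptic_simple_action_def)
  obtain x where x: "x \<in> M"
    using nonempty by blast
  have "\<not> med_bounded M m (orbit G \<phi> x)"
    using assms x by (auto simp: nonelliptic_simple_action_def elliptic_def)
  moreover have "orbit G \<phi> x \<subseteq> M"
    using x act_closed by (auto simp: orbit_def)
  ultimately obtain y z where yz: "y \<in> M" "z \<in> M" "\<not> med_dist M m y z \<le> 0"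
    unfolding med_bounded_def by blast
  then have "separating M m y z \<noteq> {}"
    by (auto simp: med_dist_def)
  then show ?thesis
    using yz unfolding separating_def proper_half_space_def by blast
qed

lemma nonelliptic_simple_action_ends:
  assumes "nonelliptic_simple_action G M m \<phi>" "proper_half_space M m H"
  shows "subgroup (stabilizer G (set_act \<phi>) H) G" "ends G (stabilizer G (set_act \<phi>) H) > 1"
proof -
  interpret median_action G M m \<phi>
    using assms(1) by (simp add: nonelliptic_simple_action_def)
  show "subgroup (stabilizer G (set_act \<phi>) H) G"
    using assms(2) half_space_subset stabilizer_set_act_subgroup
    unfolding proper_half_space_def by blast
  show "ends G (stabilizer G (set_act \<phi>) H) > 1"
    using assms ends_simple_half_space unfolding nonelliptic_simple_action_def by blast
qed

lemma essential_action_ends: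
  assumes "essential_action G M m \<phi>" "essential_half_space G M m \<phi> H"
  shows "subgroup (stabilizer G (set_act \<phi>) H) G" "ends G (stabilizer G (set_act \<phi>) H) > 1"
proof -
  interpret median_action G M m \<phi>
    using assms(1) by (simp add: essential_action_def)
  show "subgroup (stabilizer G (set_act \<phi>) H) G"
    using assms(2) half_space_subset stabilizer_set_act_subgroup
    unfolding essential_half_space_def by blast
  show "ends G (stabilizer G (set_act \<phi>) H) > 1"
    using assms ends_essential_half_space unfolding essential_action_def by blast
qed

theorem theorem11p5:
  fixes G :: "('g, 'x) monoid_scheme"
  assumes "group G"
  shows
    "((\<exists>K. subgroup K G \<and> ends G K > 1) \<longleftrightarrow>
        (\<exists>(M :: 'g set set set) m \<phi>. nonelliptic_simple_action G M m \<phi>)) \<and>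
     ((\<exists>K. subgroup K G \<and> ends G K > 1) \<longleftrightarrow>
        (\<exists>(M :: 'g set set set) m \<phi>. essential_action G M m \<phi>)) \<and>
     ((\<exists>(M :: 'm set) m \<phi>. nonelliptic_simple_action G M m \<phi>) \<longrightarrow>
        (\<exists>K. subgroup K G \<and> ends G K > 1)) \<and>
     ((\<exists>(M :: 'm set) m \<phi>. essential_action G M m \<phi>) \<longrightarrow>
        (\<exists>K. subgroup K G \<and> ends G K > 1)) \<and>
     (\<forall>(M :: 'm set) m \<phi> H.
        nonelliptic_simple_action G M m \<phi> \<and> proper_half_space M m H \<longrightarrow>
          ends G (stabilizer G (set_act \<phi>) H) > 1) \<and>
     (\<forall>(M :: 'm set) m \<phi> H.
        essential_action G M m \<phi> \<and> essential_half_space G M m \<phi> H \<longrightarrow>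
          ends G (stabilizer G (set_act \<phi>) H) > 1) \<and>
     (\<forall>K. subgroup K G \<and> ends G K > 1 \<longrightarrow>
        (\<exists>(M :: 'g set set set) m \<phi> H.
           nonelliptic_simple_action G M m \<phi> \<and> proper_half_space M m H \<and>
           finite_index_in G K (stabilizer G (set_act \<phi>) H)) \<and>
        (\<exists>(M :: 'g set set set) m \<phi> H.
           essential_action G M m \<phi> \<and> essential_half_space G M m \<phi> H \<and>
           finite_index_in G K (stabilizer G (set_act \<phi>) H)))"
proof -
  have dual: "\<exists>(M :: 'g set set set) m \<phi> H. nonelliptic_simple_action G M m \<phi> \<and>
      essential_action G M m \<phi> \<and> proper_half_space M m H \<and> essential_half_space G M m \<phi> H \<and>
      finite_index_in G K (stabilizer G (set_act \<phi>) H)"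
    if K: "subgroup K G" "ends G K > 1" for K
  proof -
    interpret subgroup_pair G K
      by (intro subgroup_pair.intro assms K(1))
    obtain A where A: "almost_invariant A" "A \<notin> K_finite_sets G K"
        "carrier G - A \<notin> K_finite_sets G K"
      using K(2) ends_gt_one_iff by blast
    show ?thesis
      using dual_action_exists[OF A] unfolding nonelliptic_simple_action_def essential_action_def
      by blast
  qed
  have simple: "\<exists>K. subgroup K G \<and> ends G K > 1"
    if "nonelliptic_simple_action G M m \<phi>" for M :: "'a set" and m \<phi>
    using that nonelliptic_simple_action_half_space nonelliptic_simple_action_ends by metis
  have essential: "\<exists>K. subgroup K G \<and> ends G K > 1"
    if "essential_action G M m \<phi>" for M :: "'a set" and m \<phi>
    using that essential_action_ends unfolding essential_action_def by metis
  show ?thesis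
  proof (intro conjI iffI impI allI)
    assume "\<exists>K. subgroup K G \<and> ends G K > 1"
    then show "\<exists>(M :: 'g set set set) m \<phi>. nonelliptic_simple_action G M m \<phi>"
      and "\<exists>(M :: 'g set set set) m \<phi>. essential_action G M m \<phi>"
      using dual by blast+
  next
    fix K assume K: "subgroup K G \<and> ends G K > 1"
    show "\<exists>(M :: 'g set set set) m \<phi> H. nonelliptic_simple_action G M m \<phi> \<and>
        proper_half_space M m H \<and> finite_index_in G K (stabilizer G (set_act \<phi>) H)"
      using dual[of K] K by blast
    show "\<exists>(M :: 'g set set set) m \<phi> H. essential_action G M m \<phi> \<and>
        essential_half_space G M m \<phi> H \<and> finite_index_in G K (stabilizer G (set_act \<phi>) H)"
      using dual[of K] K by blast
  next
    fix M :: "'m set" and m \<phi> H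
    assume "nonelliptic_simple_action G M m \<phi> \<and> proper_half_space M m H"
    then show "ends G (stabilizer G (set_act \<phi>) H) > 1"
      using nonelliptic_simple_action_ends(2) by blast
  next
    fix M :: "'m set" and m \<phi> H
    assume "essential_action G M m \<phi> \<and> essential_half_space G M m \<phi> H"
    then show "ends G (stabilizer G (set_act \<phi>) H) > 1"
      using essential_action_ends(2) by blast
  qed (use simple essential in \<open>metis+\<close>)
qed

end
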